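(* Let $T:X\to X$ be a conservative ergodic measure-preserving transformation of the measure space $(X,\mathcal B,\mu)$, where $\mu$ is $\sigma$-finite with $\mu(X)=\infty$, and let $E\in\mathcal B$ with $\mu(E)=1$. Let $\varphi_E$ be the first return time to $E$, $T_E$ the induced map on $E$, and $A_{>n}=\{x\in E:\varphi_E(x)>n\}$. Assume that: (i) the sequence of random variables $(\varphi_E\circ T_E^{\,n-1})_{n\ge 1}$ on the probability space $(E,\mu)$ is $\psi$-mixing with coefficient $\psi(n)$ fulfilling $\sum_{n\ge 1}\psi(n)/n<\infty$; (ii) $\displaystyle\sum_{n\ge 1}\frac{n\,(\mu(A_{>n}))^2}{\big(\sum_{j=0}^{n-1}\mu(A_{>j})\big)^2}<\infty .$ Then for all $f\in L^1(X,\mu)$ and for $\mu$-a.e. $x\in X$ $$\lim_{N\to\infty}\frac{1}{\alpha(N)}\sum_{k=1}^{N+m(N,E,x)}(f\circ T^{k-1})(x)=\int_X f\,d\mu ,\qquad\text{where}\quad \alpha(n):=\frac{n}{\sum_{j=0}^{n-1}\mu(A_{>j})}$$ and $m(N,E,x)$ is the longest excursion out of $E$ beginning in the first $N$ steps (defined in the context).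
   Context: First return time: $\varphi_E:E\to\mathbb N$, $\varphi_E(x)=\min\{k\ge1: T^k(x)\in E\}$, finite for $\mu$-a.e. $x\in E$. Induced map: $T_E(x)=T^{\varphi_E(x)}(x)$, an ergodic measure-preserving transformation of the probability space $(E,\mathcal B|_E,\mu)$. $\psi$-mixing: for a sequence $(Y_n)$ of random variables on a probability space with probability $\mathbb P$, let $\mathcal F_h^k$ be the $\sigma$-field generated by $(Y_n)_{h\le n\le k}$ and set $$\psi(n)=\sup\Big\{\Big|\tfrac{\mathbb P(B\cap C)}{\mathbb P(B)\mathbb P(C)}-1\Big|: B\in\mathcal F_0^j,\ C\in\mathcal F_{j+n}^\infty,\ \mathbb P(B)>0,\ \mathbb P(C)>0,\ j\in\mathbb N\Big\}.$$ The sequence is $\psi$-mixing if $\psi(n)\to0$ as $n\to\infty$. Longest excursion out of $E$ beginning in the first $N$ steps: for $\mu$-a.e. $x\in X$, $$m(N,E,x)=1+\max\{k\ge1:\exists\,\ell\in\{1,\dots,N+1\}\text{ such that }T^{\ell+j}(x)\notin E\ \ \forall j=0,\dots,k-1\},$$ where the maximum of the empty set is taken to be $0$ (for a.e. $x$ the set is non-empty for all large $N$). *)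

theory Defs
  imports "HOL-Probability.Probability"
begin

definition measure_preserving :: "'a measure \<Rightarrow> ('a \<Rightarrow> 'a) \<Rightarrow> bool" where
  "measure_preserving M T \<longleftrightarrow>
     T \<in> measurable M M \<and>
     (\<forall>A\<in>sets M. emeasure M (T -` A \<inter> space M) = emeasure M A)"

text \<open>Conservativity in the sense of Hopf: every wandering set is a null set.\<close>

definition wandering_set :: "'a measure \<Rightarrow> ('a \<Rightarrow> 'a) \<Rightarrow> 'a set \<Rightarrow> bool" where
  "wandering_set M T W \<longleftrightarrow>
     W \<in> sets M \<and> disjoint_family (\<lambda>n. (T ^^ n) -` W \<inter> space M)"

definition conservative :: "'a measure \<Rightarrow> ('a \<Rightarrow> 'a) \<Rightarrow> bool" where
  "conservative M T \<longleftrightarrow> (\<forall>W. wandering_set M T W \<longrightarrow> emeasure M W = 0)"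

definition ergodic :: "'a measure \<Rightarrow> ('a \<Rightarrow> 'a) \<Rightarrow> bool" where
  "ergodic M T \<longleftrightarrow>
     (\<forall>A\<in>sets M. T -` A \<inter> space M = A \<longrightarrow>
        emeasure M A = 0 \<or> emeasure M (space M - A) = 0)"

text \<open>On points that never return to \<open>E\<close> (a null set in the conservative case) the infimum
  of the empty set makes the return time \<open>0\<close> and the induced map the identity.\<close>

definition return_time :: "('a \<Rightarrow> 'a) \<Rightarrow> 'a set \<Rightarrow> 'a \<Rightarrow> nat" where
  "return_time T E x = Inf {k. 1 \<le> k \<and> (T ^^ k) x \<in> E}"

definition induced_map :: "('a \<Rightarrow> 'a) \<Rightarrow> 'a set \<Rightarrow> 'a \<Rightarrow> 'a" where
  "induced_map T E x = (T ^^ return_time T E x) x"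

definition return_tail :: "('a \<Rightarrow> 'a) \<Rightarrow> 'a set \<Rightarrow> nat \<Rightarrow> 'a set" where
  "return_tail T E n = {x \<in> E. return_time T E x > n}"

definition alpha :: "'a measure \<Rightarrow> ('a \<Rightarrow> 'a) \<Rightarrow> 'a set \<Rightarrow> nat \<Rightarrow> real" where
  "alpha M T E n = real n / (\<Sum>j<n. measure M (return_tail T E j))"

text \<open>On \<open>nat\<close>, \<open>Sup\<close> is the maximum, with \<open>Sup {} = 0\<close>. The set is unbounded only if
  the orbit of \<open>x\<close> eventually stays outside \<open>E\<close>.\<close>

definition longest_excursion :: "('a \<Rightarrow> 'a) \<Rightarrow> nat \<Rightarrow> 'a set \<Rightarrow> 'a \<Rightarrow> nat" where
  "longest_excursion T N E x =
     1 + Sup {k. 1 \<le> k \<and> (\<exists>l\<in>{1..N + 1}. \<forall>j<k. (T ^^ (l + j)) x \<notin> E)}"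

definition generated_events ::
  "'a measure \<Rightarrow> 'b measure \<Rightarrow> (nat \<Rightarrow> 'a \<Rightarrow> 'b) \<Rightarrow> nat set \<Rightarrow> 'a set set" where
  "generated_events P S Y I =
     sigma_sets (space P) {Y i -` A \<inter> space P | i A. i \<in> I \<and> A \<in> sets S}"

text \<open>The sequence is indexed by \<open>nat\<close>, starting at \<open>0\<close>. The coefficient may be infinite,
  hence the supremum is taken in \<open>ennreal\<close>.\<close>

definition psi_coeff ::
  "'a measure \<Rightarrow> 'b measure \<Rightarrow> (nat \<Rightarrow> 'a \<Rightarrow> 'b) \<Rightarrow> nat \<Rightarrow> ennreal" where
  "psi_coeff P S Y n =
     Sup {ennreal \<bar>measure P (B \<inter> C) / (measure P B * measure P C) - 1\<bar> | B C j.
            B \<in> generated_events P S Y {0..j} \<and>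
            C \<in> generated_events P S Y {j + n..} \<and>
            measure P B > 0 \<and> measure P C > 0}"

definition psi_mixing :: "'a measure \<Rightarrow> 'b measure \<Rightarrow> (nat \<Rightarrow> 'a \<Rightarrow> 'b) \<Rightarrow> bool" where
  "psi_mixing P S Y \<longleftrightarrow> psi_coeff P S Y \<longlonglongrightarrow> 0"

text \<open>Indexed from \<open>0\<close>: the \<open>n\<close>-th term is the duration of the \<open>(n + 1)\<close>-st excursion.\<close>

definition return_times :: "('a \<Rightarrow> 'a) \<Rightarrow> 'a set \<Rightarrow> nat \<Rightarrow> 'a \<Rightarrow> nat" where
  "return_times T E n = return_time T E \<circ> (induced_map T E ^^ n)"

end

theory Submission
  imports Defs
begin

text \<open>
  By the ratio ergodic theorem (a consequence of Garsia's maximal inequality, since the set of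
  points with unbounded ergodic sums is invariant) it suffices to treat the indicator function
  of \<open>E\<close>, that is, to count the visits to \<open>E\<close>. Let \<open>S n\<close> be the time of the \<open>n\<close>-th return of
  a point of \<open>E\<close> and let the trimmed sum \<open>S' n\<close> be \<open>S n\<close> minus the longest of the first \<open>n\<close>
  excursions. Waiting until time \<open>N + m(N)\<close> compensates exactly for the trimming: every \<open>j\<close> with
  \<open>S' j < N\<close> satisfies \<open>S j < N + m(N)\<close>, and the latter implies \<open>S' j \<le> N\<close>. So the claim is a
  strong law of large numbers for the trimmed sums of the return times.

  With \<open>L n = \<Sum>j<n. \<mu>(A_{>j})\<close>, that law says that \<open>S'\<close> at \<open>s \<alpha>(2^k)\<close> is about \<open>s 2^k\<close>. Split
  the first \<open>3 \<alpha>(2^k)\<close> return times into \<open>3 \<cdot> 2^r\<close> blocks and truncate them at \<open>2^(k-r)\<close>. By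
  Chebyshev's inequality a block sum deviates from its mean with a probability \<open>\<beta>_k\<close> that need not
  be summable, but both series in the hypotheses make \<open>\<beta>_k^2\<close> summable. By \<open>\<psi>\<close>-mixing, the
  square controls the probability that two blocks deviate, and, by a first passage argument, also
  the probability that a single block sum is several times its mean. Likewise at most one
  of the return times exceeds the truncation level, and trimming removes it.
\<close>

section \<open>The ratio ergodic theorem\<close>

text \<open>Two facts are behind the block scheme. First, \<open>tail_ratio k\<close> is the
  expected number of return times above 2^k among \<alpha>(2^k) of them. The second hypothesis makes
  it square-summable, which controls two exceedances but not a single one; this is why one term has
  to be trimmed. The same square-summability passes to the relative variance of the truncated sums,
  so the events that enter Borel-Cantelli must be quadratic in it. Second, the unit of error is w =
  2^k / 2^r, which is both the approximate mean of one block and the truncation level. The deviating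
  block, the other blocks together, the drift of the means and the trimmed term each cost a bounded
  number of units, while any N in [2^k, 2^(k+1)) is at least 2^r units; so the relative error is
  small once r is large. Truncating at w instead of 2^k does not change the mean to first order,
  because L varies slowly. All this gives the limit on E; for other points it is pulled back along
  the orbit, one step at a time.\<close>

locale recurrent_system =
  fixes M :: "'a measure" and T :: "'a \<Rightarrow> 'a" and E :: "'a set"
  assumes T_meas [measurable]: "T \<in> measurable M M"
    and T_pres: "\<And>A. A \<in> sets M \<Longrightarrow> emeasure M (T -` A \<inter> space M) = emeasure M A"
    and conserv: "conservative M T"
    and ergod: "ergodic M T"
    and E_sets [measurable]: "E \<in> sets M"
    and E_one: "emeasure M E = 1"
begin

lemma distr_T: "distr M M T = M"
  by (rule measure_eqI) (auto simp: emeasure_distr T_pres)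

lemma funpow_meas [measurable]: "(T ^^ n) \<in> measurable M M"
  by (induction n) auto

lemma AE_T: "AE x in M. P x \<Longrightarrow> AE x in M. P (T x)"
  using AE_distrD[OF T_meas, of P] unfolding distr_T .

lemma AE_funpow: "AE x in M. P x \<Longrightarrow> AE x in M. P ((T ^^ n) x)"
proof (induction n)
  case (Suc n)
  from AE_T[OF Suc.IH[OF Suc.prems]] show ?case by (simp add: funpow_swap1)
qed simp

lemma integral_T:
  fixes h :: "'a \<Rightarrow> real"
  assumes [measurable]: "h \<in> borel_measurable M"
  shows "(\<integral>x. h (T x) \<partial>M) = (\<integral>x. h x \<partial>M)"
  using integral_distr[OF T_meas assms] by (simp add: distr_T)

lemma integrable_T:
  fixes h :: "'a \<Rightarrow> real"
  assumes "integrable M h"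
  shows "integrable M (\<lambda>x. h (T x))"
  using integrable_distr[OF T_meas, of h] assms by (simp add: distr_T)

section \<open>Garsia's maximal inequality\<close>

definition birkhoff :: "('a \<Rightarrow> real) \<Rightarrow> nat \<Rightarrow> 'a \<Rightarrow> real" where
  "birkhoff h n x = (\<Sum>k<n. h ((T ^^ k) x))"

lemma birkhoff_Suc: "birkhoff h (Suc n) x = h x + birkhoff h n (T x)"
  unfolding birkhoff_def by (simp add: sum.lessThan_Suc_shift funpow_swap1 del: sum.lessThan_Suc)

lemma birkhoff_meas [measurable]:
  assumes [measurable]: "h \<in> borel_measurable M"
  shows "birkhoff h n \<in> borel_measurable M"
  unfolding birkhoff_def by measurable

text \<open>This is the maximum of \<open>birkhoff h j x\<close> over j \<le> n. The recursive form
  is the identity on which Garsia's argument rests.\<close>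

primrec max_birkhoff :: "('a \<Rightarrow> real) \<Rightarrow> nat \<Rightarrow> 'a \<Rightarrow> real" where
  "max_birkhoff h 0 x = 0"
| "max_birkhoff h (Suc n) x = max 0 (h x + max_birkhoff h n (T x))"

lemma max_birkhoff_nonneg: "0 \<le> max_birkhoff h n x"
  by (cases n) auto

lemma max_birkhoff_mono: "max_birkhoff h n x \<le> max_birkhoff h (Suc n) x"
proof (induction n arbitrary: x)
  case (Suc n)
  from Suc[of "T x"] show ?case by (simp del: max_birkhoff.simps(2) add: max_birkhoff.simps(2)[of h "Suc n"] max_birkhoff.simps(2)[of h n x])
qed (simp add: max_birkhoff_nonneg)

lemma birkhoff_le_max: "birkhoff h n x \<le> max_birkhoff h n x"
proof (induction n arbitrary: x)
  case (Suc n)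
  from Suc[of "T x"] show ?case by (simp add: birkhoff_Suc)
qed (simp add: birkhoff_def)

lemma max_birkhoff_integrable:
  assumes "integrable M h"
  shows "integrable M (max_birkhoff h n)"
proof (induction n)
  case (Suc n)
  show ?case using assms integrable_T[OF Suc] by simp
qed simp

text \<open>Garsia's argument. Where \<open>max_birkhoff h (Suc n)\<close> is positive it equals h
  plus \<open>max_birkhoff h n\<close> at T x, and elsewhere it is 0, which is at most the latter.
  Integrating and cancelling the integral of \<open>max_birkhoff h n\<close>, which T preserves,
  leaves a nonnegative integral of h over the set where the maximum is positive. These sets exhaust
  the space almost everywhere.\<close>

lemma maximal_ergodic:
  fixes h :: "'a \<Rightarrow> real"
  assumes h: "integrable M h" and pos: "AE x in M. \<exists>n. birkhoff h n x > 0"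
  shows "0 \<le> (\<integral>x. h x \<partial>M)"
proof -
  have [measurable]: "h \<in> borel_measurable M" using h by auto
  have [measurable]: "max_birkhoff h n \<in> borel_measurable M" for n
    using max_birkhoff_integrable[OF h] by auto
  let ?g = "\<lambda>n x. h x * indicator {x\<in>space M. max_birkhoff h n x > 0} x"
  have lim: "(\<lambda>n. \<integral>x. ?g n x \<partial>M) \<longlonglongrightarrow> (\<integral>x. h x \<partial>M)"
  proof (rule integral_dominated_convergence[where w = "\<lambda>x. \<bar>h x\<bar>"])
    show "AE x in M. (\<lambda>n. ?g n x) \<longlonglongrightarrow> h x"
      using pos AE_space
    proof eventually_elim
      case (elim x)
      then obtain n0 where n0: "birkhoff h n0 x > 0" by blast
      have mono: "incseq (\<lambda>n. max_birkhoff h n x)"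
        by (rule incseq_SucI) (rule max_birkhoff_mono)
      have "max_birkhoff h n x > 0" if "n \<ge> n0" for n
        using incseqD[OF mono that] birkhoff_le_max[of h n0 x] n0 by simp
      then have "\<forall>\<^sub>F n in sequentially. ?g n x = h x"
        using elim(2) by (intro eventually_sequentiallyI[of n0]) auto
      then show ?case by (rule tendsto_eventually)
    qed
  qed (use h in \<open>auto simp: indicator_def\<close>)
  have "0 \<le> (\<integral>x. ?g (Suc n) x \<partial>M)" for n
  proof -
    have int: "integrable M (?g (Suc n))"
      using h by (intro integrable_mult_indicator[where 'b=real, simplified mult.commute real_scaleR_def] ) auto
    have "(\<integral>x. max_birkhoff h n x \<partial>M) \<le> (\<integral>x. max_birkhoff h (Suc n) x \<partial>M)"
      by (intro integral_mono max_birkhoff_integrable h max_birkhoff_mono)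
    also have "\<dots> \<le> (\<integral>x. ?g (Suc n) x + max_birkhoff h n (T x) \<partial>M)"
    proof (rule integral_mono)
      show "max_birkhoff h (Suc n) x \<le> ?g (Suc n) x + max_birkhoff h n (T x)"
        if "x \<in> space M" for x
        using that max_birkhoff_nonneg[of h n "T x"] by (auto simp: indicator_def)
    qed (intro Bochner_Integration.integrable_add int integrable_T max_birkhoff_integrable h)+
    also have "\<dots> = (\<integral>x. ?g (Suc n) x \<partial>M) + (\<integral>x. max_birkhoff h n (T x) \<partial>M)"
      by (intro Bochner_Integration.integral_add int integrable_T max_birkhoff_integrable h)
    finally show ?thesis by (simp add: integral_T)
  qed
  then show ?thesis using LIMSEQ_le_const[OF LIMSEQ_Suc[OF lim]] by blast
qed

text \<open>Sums along x and along T x differ by the fixed number h x, so unboundedness is an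
  invariant property. If it held almost everywhere, some sum would be positive almost everywhere and
  \<open>maximal_ergodic\<close> would contradict the negative integral.\<close>

lemma birkhoff_bounded_above:
  fixes h :: "'a \<Rightarrow> real"
  assumes h: "integrable M h" and neg: "(\<integral>x. h x \<partial>M) < 0"
  shows "AE x in M. \<exists>K. \<forall>n. birkhoff h n x \<le> K"
proof -
  have [measurable]: "h \<in> borel_measurable M" using h by auto
  define A where "A = {x\<in>space M. \<forall>K::nat. \<exists>n. birkhoff h n x > real K}"
  have [measurable]: "A \<in> sets M" unfolding A_def by measurable
  have unb: "(\<forall>K::nat. \<exists>n. birkhoff h n x > real K) \<longleftrightarrow> (\<forall>K::real. \<exists>n. birkhoff h n x > K)" for x
    by (meson order_le_less_trans real_arch_simple)
  have step: "(\<forall>K::real. \<exists>n. birkhoff h n (T x) > K) \<longleftrightarrow> (\<forall>K::real. \<exists>n. birkhoff h n x > K)" for x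
  proof
    assume L: "\<forall>K::real. \<exists>n. birkhoff h n (T x) > K"
    show "\<forall>K::real. \<exists>n. birkhoff h n x > K"
    proof
      fix K
      from L obtain n where "birkhoff h n (T x) > K - h x" by blast
      then have "birkhoff h (Suc n) x > K" by (simp add: birkhoff_Suc)
      then show "\<exists>n. birkhoff h n x > K" by blast
    qed
  next
    assume L: "\<forall>K::real. \<exists>n. birkhoff h n x > K"
    show "\<forall>K::real. \<exists>n. birkhoff h n (T x) > K"
    proof
      fix K
      \<comment> \<open>The bound is at least 0, which rules out n = 0 and lets the first term be
        split off.\<close>
      from L obtain n where n: "birkhoff h n x > max 0 (K + h x)" by blast
      then obtain n' where "n = Suc n'" by (cases n) (auto simp: birkhoff_def)
      then have "birkhoff h n' (T x) > K" using n by (simp add: birkhoff_Suc)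
      then show "\<exists>n. birkhoff h n (T x) > K" by blast
    qed
  qed
  have "T -` A \<inter> space M = A"
    unfolding A_def unb using step measurable_space[OF T_meas] by auto
  then consider "emeasure M A = 0" | "emeasure M (space M - A) = 0"
    using ergod \<open>A \<in> sets M\<close> unfolding ergodic_def by blast
  then show ?thesis
  proof cases
    case 1
    then have "AE x in M. x \<notin> A" by (intro AE_not_in) (auto simp: null_sets_def)
    then show ?thesis
      by (rule AE_mp) (rule AE_I2, auto simp: A_def not_less)
  next
    case 2
    then have "AE x in M. x \<notin> space M - A" by (intro AE_not_in) (auto simp: null_sets_def)
    then have "AE x in M. \<exists>n. birkhoff h n x > 0"
      by (rule AE_mp) (rule AE_I2, use of_nat_0 in \<open>auto simp: A_def; metis\<close>)
    from maximal_ergodic[OF h this] neg show ?thesis by simp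
  qed
qed

section \<open>Recurrence to E\<close>

lemma AE_returns: "AE x in M. x \<in> E \<longrightarrow> (\<exists>k\<ge>1. (T ^^ k) x \<in> E)"
proof -
  \<comment> \<open>No orbit meets W twice: the later visit would be a return of the earlier point
    to E.\<close>
  define W where "W = {x\<in>space M. x \<in> E \<and> (\<forall>k. (T ^^ Suc k) x \<notin> E)}"
  have [measurable]: "W \<in> sets M" unfolding W_def by measurable
  have "(T ^^ m) -` W \<inter> (T ^^ n) -` W = {}" if "m < n" for m n
  proof -
    have "n = Suc (n - m - 1) + m" using that by simp
    then have "(T ^^ n) x = (T ^^ Suc (n - m - 1)) ((T ^^ m) x)" for x
      by (metis funpow_add o_apply)
    then show ?thesis unfolding W_def by auto
  qed
  then have "wandering_set M T W"
    unfolding wandering_set_def disjoint_family_on_def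
    by (auto simp: W_def[symmetric]) (metis IntI Int_iff empty_iff linorder_neqE_nat vimage_eq)
  then have "W \<in> null_sets M" using conserv by (auto simp: conservative_def null_sets_def)
  from AE_not_in[OF this] show ?thesis
  proof (rule AE_mp, intro AE_I2 impI)
    fix x assume "x \<in> space M" "x \<notin> W" "x \<in> E"
    then obtain k where "(T ^^ Suc k) x \<in> E" unfolding W_def by blast
    then show "\<exists>k\<ge>1. (T ^^ k) x \<in> E" by (intro exI[of _ "Suc k"]) auto
  qed
qed

text \<open>Pointwise facts about return times are proved for these points. The property passes
  between x and T x in both directions, holds almost everywhere, and keeps the infimum in
  \<open>return_time\<close> away from the empty set.\<close>

definition recurrent :: "'a \<Rightarrow> bool" where
  "recurrent x \<longleftrightarrow> (\<forall>n. \<exists>k\<ge>n. (T ^^ k) x \<in> E)"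

lemma recurrent_T: "recurrent (T x) \<longleftrightarrow> recurrent x"
proof
  show "recurrent (T x) \<Longrightarrow> recurrent x"
    unfolding recurrent_def by (metis Suc_leD Suc_le_mono comp_apply funpow_Suc_right le_SucI)
  assume R: "recurrent x"
  show "recurrent (T x)" unfolding recurrent_def
  proof
    fix n
    from R obtain k where "k \<ge> Suc n" "(T ^^ k) x \<in> E" unfolding recurrent_def by blast
    then show "\<exists>k\<ge>n. (T ^^ k) (T x) \<in> E"
      by (intro exI[of _ "k - 1"]) (cases k, auto simp: funpow_swap1)
  qed
qed

lemma recurrent_funpow: "recurrent ((T ^^ n) x) \<longleftrightarrow> recurrent x"
  by (induction n) (auto simp: recurrent_T)

text \<open>The set is invariant, so it or its complement is null. It contains almost every point of
  E, because \<open>AE_returns\<close> holds along the whole orbit and one return leads to the next;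
  as E has mass 1, it is not null.\<close>

lemma AE_recurrent: "AE x in M. recurrent x"
proof -
  define R where "R = {x\<in>space M. recurrent x}"
  have [measurable]: "R \<in> sets M" unfolding R_def recurrent_def by measurable
  have "T -` R \<inter> space M = R"
    unfolding R_def using measurable_space[OF T_meas] by (auto simp: recurrent_T)
  then consider "emeasure M R = 0" | "emeasure M (space M - R) = 0"
    using ergod \<open>R \<in> sets M\<close> unfolding ergodic_def by blast
  then show ?thesis
  proof cases
    case 1
    have "AE x in M. \<forall>n. (T ^^ n) x \<in> E \<longrightarrow> (\<exists>k\<ge>1. (T ^^ k) ((T ^^ n) x) \<in> E)"
      unfolding AE_all_countable using AE_funpow[OF AE_returns] by blast
    then have "AE x in M. x \<in> E \<longrightarrow> recurrent x"
    proof eventually_elim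
      case (elim x)
      have "\<exists>k\<ge>n. (T ^^ k) x \<in> E" if "x \<in> E" for n
      proof (induction n)
        case 0 show ?case using that by (intro exI[of _ 0]) simp
      next
        case (Suc n)
        then obtain k where k: "k \<ge> n" "(T ^^ k) x \<in> E" by blast
        with elim obtain j where "j \<ge> 1" "(T ^^ j) ((T ^^ k) x) \<in> E" by blast
        then show ?case using k by (intro exI[of _ "j + k"]) (auto simp: funpow_add)
      qed
      then show ?case unfolding recurrent_def by blast
    qed
    moreover have "AE x in M. x \<notin> R" using 1 by (intro AE_not_in) (auto simp: null_sets_def)
    ultimately have "AE x in M. x \<notin> E"
    proof (rule AE_mp[OF AE_conjI], intro AE_I2 impI)
      fix x assume "x \<in> space M" "(x \<in> E \<longrightarrow> recurrent x) \<and> x \<notin> R"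
      then show "x \<notin> E" unfolding R_def by blast
    qed
    then have "emeasure M E = 0"
      using AE_iff_null_sets E_sets by blast
    then show ?thesis using E_one by simp
  next
    case 2
    then have "AE x in M. x \<notin> space M - R" by (intro AE_not_in) (auto simp: null_sets_def)
    then show ?thesis by (rule AE_mp) (rule AE_I2, auto simp: R_def)
  qed
qed

section \<open>The ratio theorem with visits to E as denominator\<close>

abbreviation visits :: "nat \<Rightarrow> 'a \<Rightarrow> real" where
  "visits \<equiv> birkhoff (indicator E)"

lemma visits_mono: "m \<le> n \<Longrightarrow> visits m x \<le> visits n x"
  unfolding birkhoff_def by (intro sum_mono2) auto

lemma visits_le: "visits (n + k) x \<le> visits n x + real k"
proof (induction k)
  case (Suc k)
  have "visits (n + Suc k) x \<le> visits (n + k) x + 1" by (simp add: birkhoff_def)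
  then show ?case using Suc by simp
qed simp

lemma visits_at_top:
  assumes "recurrent x"
  shows "filterlim (\<lambda>n. visits n x) at_top sequentially"
proof -
  have "\<exists>n. visits n x \<ge> real j" for j
  proof (induction j)
    case 0 then show ?case by (intro exI[of _ 0]) (simp add: birkhoff_def)
  next
    case (Suc j)
    then obtain n where n: "visits n x \<ge> real j" by blast
    from assms obtain k where k: "k \<ge> n" "(T ^^ k) x \<in> E" unfolding recurrent_def by blast
    have "visits (Suc k) x = visits k x + 1" using k by (simp add: birkhoff_def)
    with visits_mono[OF k(1), of x] n show ?case by (intro exI[of _ "Suc k"]) simp
  qed
  then show ?thesis
    unfolding filterlim_at_top eventually_sequentially
    by (meson order_trans real_arch_simple visits_mono)
qed

lemma E_integral: "(\<integral>x. indicator E x \<partial>M) = (1::real)" "integrable M (indicator E :: 'a \<Rightarrow> real)"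
  using E_one by (auto simp: measure_def)

text \<open>The function f - c 1_E has negative integral because E has measure 1.\<close>

lemma ratio_upper:
  fixes f :: "'a \<Rightarrow> real"
  assumes f: "integrable M f" and c: "(\<integral>x. f x \<partial>M) < c"
  shows "AE x in M. \<exists>K. \<forall>n. birkhoff f n x \<le> c * visits n x + K"
proof -
  have "AE x in M. \<exists>K. \<forall>n. birkhoff (\<lambda>x. f x - c * indicator E x) n x \<le> K"
    by (rule birkhoff_bounded_above) (use f c E_integral in auto)
  moreover have "birkhoff (\<lambda>x. f x - c * indicator E x) n x = birkhoff f n x - c * visits n x" for n x
    by (simp add: birkhoff_def sum_subtractf sum_distrib_left)
  ultimately show ?thesis by (simp add: algebra_simps)
qed

text \<open>\<open>ratio_upper\<close> is applied to f and -f, with c within 1 / (i + 1) of the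
  integral. The additive constants disappear because the number of visits tends to infinity.\<close>

lemma hopf_ratio:
  fixes f :: "'a \<Rightarrow> real"
  assumes f: "integrable M f"
  shows "AE x in M. (\<lambda>n. birkhoff f n x / visits n x) \<longlonglongrightarrow> (\<integral>x. f x \<partial>M)"
proof -
  define I where "I = (\<integral>x. f x \<partial>M)"
  have neg: "birkhoff (\<lambda>x. - f x) n x = - birkhoff f n x" for n x
    by (simp add: birkhoff_def sum_negf)
  have up: "AE x in M. \<forall>i. \<exists>K. \<forall>n. birkhoff f n x \<le> (I + 1 / real (Suc i)) * visits n x + K"
    unfolding AE_all_countable using ratio_upper[OF f] by (auto simp: I_def)
  have lo: "AE x in M. \<forall>i. \<exists>K. \<forall>n. - birkhoff f n x \<le> (- I + 1 / real (Suc i)) * visits n x + K"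
    unfolding AE_all_countable
    using ratio_upper[of "\<lambda>x. - f x"] f by (auto simp: I_def neg)
  show ?thesis
    using up lo AE_recurrent
  proof eventually_elim
    case (elim x)
    note top = visits_at_top[OF elim(3)]
    show ?case unfolding I_def[symmetric]
    proof (rule LIMSEQ_I)
      fix e :: real assume "e > 0"
      then obtain i where i: "1 / real (Suc i) < e / 2"
        by (metis half_gt_zero nat_approx_posE)
      from elim(1) obtain K where K: "\<And>n. birkhoff f n x \<le> (I + 1 / real (Suc i)) * visits n x + K" by blast
      from elim(2) obtain K' where K': "\<And>n. - birkhoff f n x \<le> (- I + 1 / real (Suc i)) * visits n x + K'" by blast
      \<comment> \<open>Past this many visits each additive constant is below e / 2 times the number
        of visits; the other e / 2 is spent on 1 / (i + 1).\<close>
      let ?B = "max 1 (2 * max K K' / e + 1)"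
      from top have "\<forall>\<^sub>F n in sequentially. visits n x \<ge> ?B"
        unfolding filterlim_at_top by blast
      then obtain n0 where n0: "\<And>n. n \<ge> n0 \<Longrightarrow> visits n x \<ge> ?B"
        unfolding eventually_sequentially by blast
      show "\<exists>no. \<forall>n\<ge>no. norm (birkhoff f n x / visits n x - I) < e"
      proof (intro exI[of _ n0] allI impI)
        fix n assume "n \<ge> n0"
        define v where "v = visits n x"
        have v: "v \<ge> 1" "v > 2 * max K K' / e" using n0[OF \<open>n \<ge> n0\<close>] by (auto simp: v_def)
        have "K < e / 2 * v" "K' < e / 2 * v" using v(2) \<open>e > 0\<close> by (auto simp: field_simps)
        moreover have "1 / real (Suc i) * v \<le> e / 2 * v" using i v(1) by (intro mult_right_mono) auto
        ultimately have "birkhoff f n x < (I + e) * v" "- birkhoff f n x < (- I + e) * v"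
          using K[of n] K'[of n] unfolding v_def[symmetric] unfolding distrib_right by linarith+
        then have "birkhoff f n x / v < I + e" "birkhoff f n x / v > I - e"
          using v(1) by (auto simp: field_simps)
        then show "norm (birkhoff f n x / visits n x - I) < e"
          unfolding v_def[symmetric] by (simp add: abs_less_iff)
      qed
    qed
  qed
qed

end

section \<open>The induced map\<close>

context recurrent_system
begin

lemma return_time_props:
  assumes "recurrent x"
  shows "1 \<le> return_time T E x" "(T ^^ return_time T E x) x \<in> E"
    and "1 \<le> i \<Longrightarrow> i < return_time T E x \<Longrightarrow> (T ^^ i) x \<notin> E"
proof -
  let ?K = "{k. 1 \<le> k \<and> (T ^^ k) x \<in> E}"
  have "?K \<noteq> {}" using assms unfolding recurrent_def by blast
  then have "Inf ?K \<in> ?K" by (rule Inf_nat_def1)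
  then show "1 \<le> return_time T E x" "(T ^^ return_time T E x) x \<in> E"
    unfolding return_time_def by auto
  show "1 \<le> i \<Longrightarrow> i < return_time T E x \<Longrightarrow> (T ^^ i) x \<notin> E"
    unfolding return_time_def using cInf_lower[of i ?K] by fastforce
qed

lemma return_time_meas [measurable]: "return_time T E \<in> measurable M (count_space UNIV)"
  unfolding return_time_def[abs_def] Inf_nat_def by simp

lemma induced_map_meas [measurable]: "induced_map T E \<in> measurable M M"
  unfolding induced_map_def[abs_def]
  by (rule measurable_compose_countable[OF _ return_time_meas]) auto

lemma induced_funpow_meas [measurable]: "(induced_map T E ^^ n) \<in> measurable M M"
  by (induction n) auto

lemma return_times_meas [measurable]: "return_times T E n \<in> measurable M (count_space UNIV)"
  unfolding return_times_def by (rule measurable_comp[OF induced_funpow_meas return_time_meas])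

lemma recurrent_induced: "recurrent (induced_map T E x) \<longleftrightarrow> recurrent x"
  unfolding induced_map_def by (rule recurrent_funpow)

lemma recurrent_induced_funpow: "recurrent ((induced_map T E ^^ n) x) \<longleftrightarrow> recurrent x"
  by (induction n) (auto simp: recurrent_induced)

lemma induced_funpow_in_E: "x \<in> E \<Longrightarrow> recurrent x \<Longrightarrow> (induced_map T E ^^ n) x \<in> E"
proof (cases n)
  case (Suc m)
  assume "recurrent x"
  then have "recurrent ((induced_map T E ^^ m) x)" by (simp add: recurrent_induced_funpow)
  then show ?thesis using return_time_props(2) by (simp add: Suc induced_map_def)
qed simp

lemma recurrent_pred [measurable]: "Measurable.pred M recurrent"
  unfolding recurrent_def by measurable

text \<open>Pulling back the event ``the first visit to \<open>E\<close> is in \<open>B\<close> and happens at time \<open>n\<close>''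
  splits off the points of \<open>E\<close> that return to \<open>B\<close> at time \<open>n + 1\<close>.\<close>

lemma induced_preimage_le:
  assumes [measurable]: "B \<in> sets M" and BE: "B \<subseteq> E"
  shows "emeasure M {x\<in>space M. x \<in> E \<and> recurrent x \<and> induced_map T E x \<in> B} \<le> emeasure M B"
proof -
  define H where "H n = {x\<in>space M. (T ^^ n) x \<in> B \<and> (\<forall>i<n. (T ^^ i) x \<notin> E)}" for n
  define F where "F k = {x\<in>space M. x \<in> E \<and> recurrent x \<and> return_time T E x = k \<and> (T ^^ k) x \<in> B}" for k
  have [measurable]: "H n \<in> sets M" "F n \<in> sets M" for n
    unfolding H_def F_def by measurable
  have step: "emeasure M (H (Suc n)) + emeasure M (F (Suc n)) \<le> emeasure M (H n)" for n
  proof -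
    have "H (Suc n) \<inter> F (Suc n) = {}"
      unfolding H_def F_def by (auto dest!: spec[of _ 0])
    then have "emeasure M (H (Suc n)) + emeasure M (F (Suc n)) = emeasure M (H (Suc n) \<union> F (Suc n))"
      by (simp add: plus_emeasure)
    also have "\<dots> \<le> emeasure M (T -` H n \<inter> space M)"
    proof (rule emeasure_mono)
      show "H (Suc n) \<union> F (Suc n) \<subseteq> T -` H n \<inter> space M"
      proof
        fix x assume x: "x \<in> H (Suc n) \<union> F (Suc n)"
        have "(T ^^ i) (T x) \<notin> E" if "i < n" for i
          using x that return_time_props(3)[of x "Suc i"]
          unfolding H_def F_def by (auto simp: funpow_swap1)
        with x show "x \<in> T -` H n \<inter> space M"
          using measurable_space[OF T_meas] unfolding H_def F_def by (auto simp: funpow_swap1)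
      qed
    qed measurable
    finally show ?thesis by (simp add: T_pres)
  qed
  \<comment> \<open>The pieces \<open>F\<close> are peeled off one at a time from
    \<open>H 0\<close>, which is B.\<close>
  have part: "(\<Sum>k<n. emeasure M (F (Suc k))) + emeasure M (H n) \<le> emeasure M B" for n
  proof (induction n)
    case 0
    have "H 0 = B" using sets.sets_into_space[OF assms(1)] by (auto simp: H_def)
    then show ?case by simp
  next
    case (Suc n)
    have "(\<Sum>k<Suc n. emeasure M (F (Suc k))) + emeasure M (H (Suc n))
      = (\<Sum>k<n. emeasure M (F (Suc k))) + (emeasure M (H (Suc n)) + emeasure M (F (Suc n)))"
      by (simp add: ac_simps)
    also have "\<dots> \<le> (\<Sum>k<n. emeasure M (F (Suc k))) + emeasure M (H n)"
      by (intro add_left_mono step)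
    finally show ?case using Suc by (rule order_trans)
  qed
  have "{x\<in>space M. x \<in> E \<and> recurrent x \<and> induced_map T E x \<in> B} = (\<Union>k. F (Suc k))"
  proof (intro equalityI subsetI)
    fix x assume x: "x \<in> {x\<in>space M. x \<in> E \<and> recurrent x \<and> induced_map T E x \<in> B}"
    then obtain k where "return_time T E x = Suc k"
      using return_time_props(1)[of x] by (cases "return_time T E x") auto
    then show "x \<in> (\<Union>k. F (Suc k))"
      using x unfolding F_def induced_map_def by (auto simp del: funpow.simps)
  next
    fix x assume "x \<in> (\<Union>k. F (Suc k))"
    then show "x \<in> {x\<in>space M. x \<in> E \<and> recurrent x \<and> induced_map T E x \<in> B}"
      unfolding F_def induced_map_def by (auto simp del: funpow.simps)
  qed
  also have "emeasure M \<dots> = (\<Sum>k. emeasure M (F (Suc k)))"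
    by (rule suminf_emeasure[symmetric]) (auto simp: disjoint_family_on_def F_def)
  also have "\<dots> \<le> emeasure M B"
  proof (rule suminf_le_const)
    show "(\<Sum>k<n. emeasure M (F (Suc k))) \<le> emeasure M B" for n
      using part[of n] by (rule order_trans[rotated]) simp
  qed simp
  finally show ?thesis .
qed

lemma AE_eq_recurrent:
  assumes [measurable]: "Measurable.pred M P"
  shows "emeasure M {x\<in>space M. recurrent x \<and> P x} = emeasure M {x\<in>space M. P x}"
  by (rule emeasure_eq_AE) (use AE_recurrent in auto)

text \<open>The inequality holds for B and for E - B. The two left sides add up to the measure of E,
  as do the two right sides, and since this is finite neither inequality can be strict.\<close>

lemma induced_preserving:
  assumes [measurable]: "B \<in> sets M" and BE: "B \<subseteq> E"
  shows "emeasure M {x\<in>space M. x \<in> E \<and> recurrent x \<and> induced_map T E x \<in> B} = emeasure M B"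
proof (rule antisym[OF induced_preimage_le[OF assms]])
  let ?F = "\<lambda>B. {x\<in>space M. x \<in> E \<and> recurrent x \<and> induced_map T E x \<in> B}"
  have sp: "{x\<in>space M. x \<in> E} = E" using sets.sets_into_space[OF E_sets] by auto
  have fin: "emeasure M (E - B) \<noteq> \<infinity>"
    using emeasure_mono[of "E - B" E M] E_one by (auto simp: top_unique)
  have "emeasure M B + emeasure M (E - B) = emeasure M (B \<union> (E - B))"
    by (rule plus_emeasure) auto
  also have "B \<union> (E - B) = E" using BE by auto
  also have "emeasure M E = emeasure M {x\<in>space M. recurrent x \<and> x \<in> E}"
    using AE_eq_recurrent[of "\<lambda>x. x \<in> E"] by (simp add: sp)
  also have "{x\<in>space M. recurrent x \<and> x \<in> E} = ?F B \<union> ?F (E - B)"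
    using return_time_props(2) unfolding induced_map_def by auto
  also have "emeasure M \<dots> = emeasure M (?F B) + emeasure M (?F (E - B))"
    by (rule plus_emeasure[symmetric]) auto
  also have "\<dots> \<le> emeasure M (?F B) + emeasure M (E - B)"
    by (intro add_left_mono induced_preimage_le) auto
  finally have "emeasure M (E - B) + emeasure M B \<le> emeasure M (E - B) + emeasure M (?F B)"
    by (simp only: add.commute)
  then show "emeasure M B \<le> emeasure M (?F B)"
    using fin unfolding ennreal_add_left_cancel_le by simp
qed

lemma induced_funpow_preserving:
  assumes [measurable]: "B \<in> sets M" and "B \<subseteq> E"
  shows "emeasure M {x\<in>space M. x \<in> E \<and> recurrent x \<and> (induced_map T E ^^ n) x \<in> B} = emeasure M B"
  using assms
proof (induction n arbitrary: B)
  case 0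
  note [measurable] = 0(1)
  have 1: "{x\<in>space M. x \<in> E \<and> recurrent x \<and> (induced_map T E ^^ 0) x \<in> B}
    = {x\<in>space M. recurrent x \<and> x \<in> B}" using 0(2) by auto
  have 2: "{x\<in>space M. x \<in> B} = B" using sets.sets_into_space[OF 0(1)] by auto
  have "emeasure M {x\<in>space M. recurrent x \<and> x \<in> B} = emeasure M {x\<in>space M. x \<in> B}"
    by (rule AE_eq_recurrent) measurable
  then show ?case unfolding 1 2 .
next
  case (Suc n)
  note [measurable] = Suc.prems(1)
  let ?B = "{x\<in>space M. x \<in> E \<and> recurrent x \<and> induced_map T E x \<in> B}"
  have eq: "{x\<in>space M. x \<in> E \<and> recurrent x \<and> (induced_map T E ^^ Suc n) x \<in> B}
    = {x\<in>space M. x \<in> E \<and> recurrent x \<and> (induced_map T E ^^ n) x \<in> ?B}"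
  proof (rule Collect_cong)
    fix x
    define y where "y = (induced_map T E ^^ n) x"
    have y: "(induced_map T E ^^ Suc n) x = induced_map T E y" by (simp add: y_def)
    have "x \<in> space M \<Longrightarrow> y \<in> space M" "x \<in> E \<Longrightarrow> recurrent x \<Longrightarrow> y \<in> E"
      "recurrent y = recurrent x"
      unfolding y_def using measurable_space[OF induced_funpow_meas]
      by (simp_all add: induced_funpow_in_E recurrent_induced_funpow)
    then show "(x \<in> space M \<and> x \<in> E \<and> recurrent x \<and> (induced_map T E ^^ Suc n) x \<in> B)
      \<longleftrightarrow> (x \<in> space M \<and> x \<in> E \<and> recurrent x \<and> (induced_map T E ^^ n) x \<in> ?B)"
      unfolding y y_def[symmetric] by blast
  qed
  have "emeasure M {x\<in>space M. x \<in> E \<and> recurrent x \<and> (induced_map T E ^^ n) x \<in> ?B} = emeasure M ?B"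
    by (rule Suc.IH) (measurable, blast)
  then show ?case unfolding eq induced_preserving[OF Suc.prems] .
qed

section \<open>Return times as random variables on E\<close>

abbreviation return_prob :: "'a measure" where
  "return_prob \<equiv> restrict_space M E"

lemma space_return_prob: "space return_prob = E"
  using sets.sets_into_space[OF E_sets] by (auto simp: space_restrict_space)

lemma prob_space_return_prob: "prob_space return_prob"
  by (rule prob_spaceI) (simp add: space_return_prob emeasure_restrict_space E_one)

lemma measure_return_prob: "A \<in> sets return_prob \<Longrightarrow> measure return_prob A = measure M A"
  by (rule measure_restrict_space) (auto simp: sets_restrict_space)

text \<open>The induced map preserves the measure on E, so all return times have the law of the
  first. It is known to keep points of E in E when they are recurrent, hence the comparison of
  events almost everywhere.\<close>

lemma return_times_identical:
  "measure return_prob {x\<in>space return_prob. return_times T E n x > j} = measure M (return_tail T E j)"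
proof -
  have sp: "E \<subseteq> space M" by (rule sets.sets_into_space[OF E_sets])
  have tail: "return_tail T E j = {x\<in>space M. x \<in> E \<and> return_time T E x > j}"
    using sp by (auto simp: return_tail_def)
  have tm [measurable]: "return_tail T E j \<in> sets M" unfolding tail by measurable
  have sub: "return_tail T E j \<subseteq> E" by (auto simp: return_tail_def)
  have rmeas: "return_times T E n \<in> measurable return_prob (count_space UNIV)"
    by (rule measurable_restrict_space1) measurable
  have ae: "AE x in M. x \<in> E \<longrightarrow> (induced_map T E ^^ n) x \<in> E"
    using AE_recurrent
    by eventually_elim (simp add: induced_funpow_in_E)
  have "measure return_prob {x\<in>space return_prob. return_times T E n x > j}
      = measure M {x\<in>space return_prob. return_times T E n x > j}"
    using measurable_sets[OF rmeas, of "{j<..}"]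
    by (intro measure_return_prob) (simp add: vimage_def Int_def conj_commute)
  also have "\<dots> = measure M {x\<in>space M. x \<in> E \<and> return_times T E n x > j}"
    using sp by (intro arg_cong[where f="measure M"]) (auto simp: space_return_prob)
  also have "\<dots> = measure M {x\<in>space M. x \<in> E \<and> recurrent x \<and> (induced_map T E ^^ n) x \<in> return_tail T E j}"
  proof (rule measure_eq_AE)
    show "AE x in M. (x \<in> {x \<in> space M. x \<in> E \<and> j < return_times T E n x}) =
               (x \<in> {x \<in> space M. x \<in> E \<and> recurrent x \<and> (induced_map T E ^^ n) x \<in> return_tail T E j})"
      using ae AE_recurrent by eventually_elim (auto simp: return_tail_def return_times_def)
  qed measurable
  also have "\<dots> = measure M (return_tail T E j)"
    unfolding measure_def by (subst induced_funpow_preserving[OF tm sub]) simp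
  finally show ?thesis .
qed

end

section \<open>Truncated means of a tail sequence\<close>

text \<open>Sum the recursion from k0 on: a partial sum of u is at most u k0 plus c times itself
  plus the total of e, and c < 1 lets it be absorbed on the left.\<close>

lemma summable_contraction:
  fixes u e :: "nat \<Rightarrow> real"
  assumes c: "0 \<le> c" "c < 1" and u: "\<And>k. 0 \<le> u k" and e: "\<And>k. 0 \<le> e k" "summable e"
    and step: "\<forall>\<^sub>F k in sequentially. u (Suc k) \<le> c * u k + e k"
  shows "summable u"
proof -
  from step obtain k0 where k0: "\<And>k. k \<ge> k0 \<Longrightarrow> u (Suc k) \<le> c * u k + e k"
    unfolding eventually_sequentially by blast
  have "(\<Sum>k<n. u (k + k0)) \<le> (u k0 + suminf e) / (1 - c)" for n
  proof -
    have sume: "(\<Sum>k<n. e (k + k0)) \<le> suminf e"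
    proof -
      have "(\<Sum>k<n. e (k + k0)) = sum e {k0..<n + k0}"
        by (simp add: sum.shift_bounds_nat_ivl[of e 0 k0 n, simplified] lessThan_atLeast0)
      also have "\<dots> \<le> suminf e" using e by (intro sum_le_suminf) auto
      finally show ?thesis .
    qed
    have "(\<Sum>k<n. u (k + k0)) \<le> u k0 + (\<Sum>k<n. u (Suc k + k0))"
    proof -
      have "(\<Sum>k<n. u (k + k0)) \<le> (\<Sum>k<Suc n. u (k + k0))" using u by simp
      also have "\<dots> = u k0 + (\<Sum>k<n. u (Suc k + k0))"
        by (subst sum.lessThan_Suc_shift) simp
      finally show ?thesis .
    qed
    also have "(\<Sum>k<n. u (Suc k + k0)) \<le> (\<Sum>k<n. c * u (k + k0) + e (k + k0))"
      by (intro sum_mono) (use k0 in auto)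
    also have "\<dots> \<le> c * (\<Sum>k<n. u (k + k0)) + suminf e"
      using sume by (simp add: sum.distrib sum_distrib_left)
    finally show ?thesis using c by (simp add: field_simps)
  qed
  then have "summable (\<lambda>k. u (k + k0))"
    using u by (intro summableI_nonneg_bounded) auto
  then show ?thesis by (simp add: summable_iff_shift)
qed

lemma summable_power2:
  fixes u :: "nat \<Rightarrow> real"
  assumes "summable u" "\<And>k. 0 \<le> u k"
  shows "summable (\<lambda>k. (u k)\<^sup>2)"
proof (rule summable_comparison_test_ev[OF _ assms(1)])
  have "\<forall>\<^sub>F k in sequentially. u k < 1"
    using summable_LIMSEQ_zero[OF assms(1)] by (rule order_tendstoD) simp
  then show "\<forall>\<^sub>F k in sequentially. norm ((u k)\<^sup>2) \<le> u k"
  proof eventually_elim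
    case (elim k)
    then show ?case using assms(2)[of k] mult_left_mono[of "u k" 1 "u k"]
      by (simp add: power2_eq_square)
  qed
qed

text \<open>The analytic data, free of probability: \<open>a n\<close> will be \<mu>(A_{>n}) and
  \<open>\<psi>\<close> the mixing coefficient with real values.\<close>

locale tail_sequence =
  fixes a \<psi> :: "nat \<Rightarrow> real"
  assumes a_0: "a 0 = 1" and a_dec: "\<And>m n. m \<le> n \<Longrightarrow> a n \<le> a m" and a_nonneg: "\<And>n. 0 \<le> a n"
    and psi_nonneg: "\<And>n. 0 \<le> \<psi> n"
    and psi_summable: "summable (\<lambda>n. \<psi> (Suc n) / real (Suc n))"
    and a_summable: "summable (\<lambda>n. real n * (a n)\<^sup>2 / (\<Sum>j<n. a j)\<^sup>2)"
begin

text \<open>By summation over tails, \<open>trunc_mean n\<close> and \<open>trunc_square n\<close>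
  are the first two moments of a return time truncated at n; the weight 2 j + 1 is (j + 1)^2 -
  j^2.\<close>

definition trunc_mean :: "nat \<Rightarrow> real" where "trunc_mean n = (\<Sum>j<n. a j)"
definition trunc_square :: "nat \<Rightarrow> real" where "trunc_square n = (\<Sum>j<n. (2 * real j + 1) * a j)"
definition psi_sum :: "nat \<Rightarrow> real" where "psi_sum n = (\<Sum>d\<in>{1..n}. \<psi> d)"

text \<open>The product of \<open>dscale i\<close> and \<open>a (2 ^ i)\<close>, where
  \<open>dscale i\<close> is \<alpha>(2^i), the number of return times whose truncated sum has mean
  2^i.\<close>

definition tail_ratio :: "nat \<Rightarrow> real" where "tail_ratio i = 2 ^ i * a (2 ^ i) / trunc_mean (2 ^ i)"
definition dscale :: "nat \<Rightarrow> real" where "dscale k = 2 ^ k / trunc_mean (2 ^ k)"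

lemma trunc_mean_mono: "m \<le> n \<Longrightarrow> trunc_mean m \<le> trunc_mean n"
  unfolding trunc_mean_def using a_nonneg by (intro sum_mono2) auto

lemma trunc_mean_ge_1: "n \<ge> 1 \<Longrightarrow> trunc_mean n \<ge> 1"
  using trunc_mean_mono[of 1 n] by (simp add: trunc_mean_def a_0)

lemma trunc_mean_pow [simp]: "trunc_mean (2 ^ k) > 0" "trunc_mean (2 ^ k) \<ge> 1" "trunc_mean (2 ^ k) \<noteq> 0"
  using trunc_mean_ge_1[of "2 ^ k"] by auto

lemma trunc_mean_add: "trunc_mean (m + n) \<le> trunc_mean m + real n * a m"
proof (induction n)
  case (Suc n)
  have "trunc_mean (m + Suc n) = trunc_mean (m + n) + a (m + n)" by (simp add: trunc_mean_def)
  also have "a (m + n) \<le> a m" by (rule a_dec) simp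
  finally show ?case using Suc by (simp add: algebra_simps)
qed simp

lemma mult_tail_le: "real n * a n \<le> trunc_mean n"
proof -
  have "real n * a n = (\<Sum>j<n. a n)" by simp
  also have "\<dots> \<le> trunc_mean n" unfolding trunc_mean_def by (intro sum_mono a_dec) auto
  finally show ?thesis .
qed

lemma tail_ratio_nonneg: "0 \<le> tail_ratio i"
  unfolding tail_ratio_def using a_nonneg by (simp add: less_imp_le)

lemma dscale_pos [simp]: "0 < dscale k" "0 \<le> dscale k" "dscale k \<noteq> 0"
  by (simp_all add: dscale_def less_imp_le)

text \<open>The increments of \<open>trunc_mean\<close> beyond 2^k are at most
  \<open>a (2 ^ k)\<close>. Once \<open>tail_ratio\<close> is known to tend to 0, this is slow
  variation.\<close>

lemma trunc_mean_double: "trunc_mean (2 ^ Suc k) \<le> (1 + tail_ratio k) * trunc_mean (2 ^ k)"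
proof -
  have "trunc_mean (2 ^ Suc k) \<le> trunc_mean (2 ^ k) + 2 ^ k * a (2 ^ k)"
    using trunc_mean_add[of "2 ^ k" "2 ^ k"] by (simp add: mult_2)
  also have "\<dots> = (1 + tail_ratio k) * trunc_mean (2 ^ k)"
    unfolding tail_ratio_def by (simp add: field_simps)
  finally show ?thesis .
qed

text \<open>Dyadic condensation of the second hypothesis. Each of the 2^i terms with 2^i \<le> n <
  2^(i+1) is bounded below by evaluating \<open>a\<close> and \<open>trunc_mean\<close> at 2^(i+1);
  the factor 4 arises because 2^i is only half of 2^(i+1).\<close>

lemma summable_tail_ratio: "summable (\<lambda>i. (tail_ratio i)\<^sup>2)"
proof -
  let ?g = "\<lambda>n. real n * (a n)\<^sup>2 / (trunc_mean n)\<^sup>2"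
  have g: "summable ?g" using a_summable unfolding trunc_mean_def .
  have "(\<Sum>i<n. (tail_ratio (Suc i))\<^sup>2) \<le> 4 * suminf ?g" for n
  proof -
    have "(tail_ratio (Suc i))\<^sup>2 \<le> 4 * sum ?g {2 ^ i..<2 ^ Suc i}" for i
    proof -
      have "(tail_ratio (Suc i))\<^sup>2 / 4 = (\<Sum>n\<in>{2 ^ i..<2 ^ Suc i::nat}. 2 ^ i * (a (2 ^ Suc i))\<^sup>2 / (trunc_mean (2 ^ Suc i))\<^sup>2)"
        unfolding tail_ratio_def by (simp add: power2_eq_square field_simps)
      also have "\<dots> \<le> sum ?g {2 ^ i..<2 ^ Suc i}"
      proof (intro sum_mono)
        fix n :: nat assume "n \<in> {2 ^ i..<2 ^ Suc i}"
        then have n: "2 ^ i \<le> n" "n \<le> 2 ^ Suc i" by auto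
        have "(1::nat) \<le> 2 ^ i" by simp
        then have "1 \<le> n" using n(1) by linarith
        then have "0 < trunc_mean n" using trunc_mean_ge_1[of n] by simp
        moreover have "(2::real) ^ i \<le> real n" using n(1) by (metis of_nat_le_iff of_nat_numeral of_nat_power)
        ultimately show "2 ^ i * (a (2 ^ Suc i))\<^sup>2 / (trunc_mean (2 ^ Suc i))\<^sup>2 \<le> ?g n"
          using a_nonneg a_dec[OF n(2)] trunc_mean_mono[OF n(2)]
          by (intro frac_le mult_mono power_mono) auto
      qed
      finally show ?thesis by simp
    qed
    then have "(\<Sum>i<n. (tail_ratio (Suc i))\<^sup>2) \<le> (\<Sum>i<n. 4 * sum ?g {2 ^ i..<2 ^ Suc i})"
      by (intro sum_mono)
    also have "\<dots> = 4 * sum ?g {1..<2 ^ n}"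
    proof (induction n)
      case (Suc n)
      have "sum ?g {1..<2 ^ n} + sum ?g {2 ^ n..<2 ^ Suc n} = sum ?g {1..<2 ^ Suc n}"
        by (rule sum.atLeastLessThan_concat) auto
      then show ?case using Suc by (simp add: algebra_simps)
    qed simp
    also have "sum ?g {1..<2 ^ n} \<le> suminf ?g"
      by (intro sum_le_suminf g) auto
    finally show ?thesis by simp
  qed
  then have "summable (\<lambda>i. (tail_ratio (Suc i))\<^sup>2)"
    by (intro summableI_nonneg_bounded) auto
  then show ?thesis by (subst (asm) summable_Suc_iff)
qed

lemma tail_ratio_lim: "tail_ratio \<longlonglongrightarrow> 0"
proof -
  have "(\<lambda>i. (tail_ratio i)\<^sup>2) \<longlonglongrightarrow> 0" by (rule summable_LIMSEQ_zero[OF summable_tail_ratio])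
  then have "(\<lambda>i. sqrt ((tail_ratio i)\<^sup>2)) \<longlonglongrightarrow> sqrt 0" by (rule tendsto_real_sqrt)
  then show ?thesis using tail_ratio_nonneg by simp
qed

text \<open>Up to covariances, this bounds the variance of a sum of \<alpha>(2^i) return times
  truncated at 2^i, relative to the square of its mean 2^i.\<close>

definition square_ratio :: "nat \<Rightarrow> real" where
  "square_ratio i = trunc_square (2 ^ i) / (2 ^ i * trunc_mean (2 ^ i))"

lemma trunc_square_nonneg: "0 \<le> trunc_square n"
  unfolding trunc_square_def using a_nonneg by (intro sum_nonneg) auto

lemma square_ratio_nonneg: "0 \<le> square_ratio i"
  unfolding square_ratio_def using trunc_square_nonneg by (simp add: less_imp_le)

text \<open>Doubling the level adds 2^i terms of size at most 4 * 2^i * a (2^i), while the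
  normalization at least doubles and so halves the old contribution.\<close>

lemma square_ratio_step: "square_ratio (Suc i) \<le> square_ratio i / 2 + 2 * tail_ratio i"
proof -
  have "trunc_square (2 ^ Suc i) = trunc_square (2 ^ i) + (\<Sum>j\<in>{2 ^ i..<2 ^ Suc i}. (2 * real j + 1) * a j)"
    unfolding trunc_square_def lessThan_atLeast0 by (rule sum.atLeastLessThan_concat[symmetric]) auto
  also have "(\<Sum>j\<in>{2 ^ i..<2 ^ Suc i}. (2 * real j + 1) * a j) \<le> (\<Sum>j\<in>{2 ^ i..<2 ^ Suc i::nat}. 4 * 2 ^ i * a (2 ^ i))"
  proof (intro sum_mono mult_mono a_dec)
    fix j :: nat assume "j \<in> {2 ^ i..<2 ^ Suc i}"
    then have "Suc j \<le> 2 ^ Suc i" by auto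
    then have "real (Suc j) \<le> 2 ^ Suc i" by (metis of_nat_le_iff of_nat_numeral of_nat_power)
    then show "2 * real j + 1 \<le> 4 * 2 ^ i" by simp
  qed (use a_nonneg in auto)
  also have "\<dots> = 4 * 2 ^ i * (2 ^ i * a (2 ^ i))" by simp
  also have "\<dots> = 4 * 2 ^ i * (tail_ratio i * trunc_mean (2 ^ i))" unfolding tail_ratio_def by simp
  finally have "trunc_square (2 ^ Suc i) \<le> trunc_square (2 ^ i) + 4 * 2 ^ i * (tail_ratio i * trunc_mean (2 ^ i))" by simp
  also have "\<dots> = (square_ratio i / 2 + 2 * tail_ratio i) * (2 ^ Suc i * trunc_mean (2 ^ i))"
    unfolding square_ratio_def by (simp add: field_simps)
  also have "\<dots> \<le> (square_ratio i / 2 + 2 * tail_ratio i) * (2 ^ Suc i * trunc_mean (2 ^ Suc i))"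
    using square_ratio_nonneg[of i] tail_ratio_nonneg[of i] trunc_mean_mono[of "2^i" "2^Suc i"]
    by (intro mult_left_mono) auto
  finally show ?thesis unfolding square_ratio_def[of "Suc i"] by (subst pos_divide_le_eq) (simp_all del: power_Suc)
qed

text \<open>By (p + q)^2 \<le> 2 p^2 + 2 q^2 the factor 1 / 2 of \<open>square_ratio_step\<close>
  turns into 2 * (1 / 4) = 1 / 2 for the squares, still a contraction.\<close>

lemma summable_square_ratio: "summable (\<lambda>i. (square_ratio i)\<^sup>2)"
proof (rule summable_contraction[where c = "1/2" and e = "\<lambda>i. 8 * (tail_ratio i)\<^sup>2"])
  show "\<forall>\<^sub>F i in sequentially. (square_ratio (Suc i))\<^sup>2 \<le> 1 / 2 * (square_ratio i)\<^sup>2 + 8 * (tail_ratio i)\<^sup>2"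
  proof (intro always_eventually allI)
    fix i
    have "(square_ratio (Suc i))\<^sup>2 \<le> (square_ratio i / 2 + 2 * tail_ratio i)\<^sup>2"
      by (intro power_mono square_ratio_step square_ratio_nonneg)
    also have "\<dots> \<le> 1 / 2 * (square_ratio i)\<^sup>2 + 8 * (tail_ratio i)\<^sup>2"
      using zero_le_power2[of "square_ratio i / 2 - 2 * tail_ratio i"]
      by (simp add: power2_eq_square algebra_simps)
    finally show "(square_ratio (Suc i))\<^sup>2 \<le> 1 / 2 * (square_ratio i)\<^sup>2 + 8 * (tail_ratio i)\<^sup>2" .
  qed
qed (use summable_tail_ratio in auto)

lemma dscale_Suc: "dscale (Suc k) * (1 + tail_ratio k) \<ge> 2 * dscale k"
proof -
  have "2 * dscale k * trunc_mean (2 ^ Suc k) \<le> 2 * dscale k * ((1 + tail_ratio k) * trunc_mean (2 ^ k))"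
     by (intro mult_left_mono trunc_mean_double) auto
  also have "\<dots> = 2 ^ Suc k * (1 + tail_ratio k)" unfolding dscale_def by simp
  finally show ?thesis unfolding dscale_def[of "Suc k"] by (simp add: field_simps del: power_Suc)
qed

text \<open>Since \<open>tail_ratio\<close> tends to 0, the factor may be any number below 2; 3 / 2
  corresponds to the threshold 1 / 3.\<close>

lemma dscale_growth: "\<forall>\<^sub>F k in sequentially. dscale (Suc k) \<ge> 3 / 2 * dscale k"
proof -
  have "\<forall>\<^sub>F k in sequentially. tail_ratio k < 1 / 3"
    using tail_ratio_lim by (rule order_tendstoD) simp
  then show ?thesis
  proof eventually_elim
    case (elim k)
    have "2 * dscale k \<le> dscale (Suc k) * (1 + tail_ratio k)" by (rule dscale_Suc)
    also have "\<dots> \<le> dscale (Suc k) * (4 / 3)" using elim dscale_pos(1) by (intro mult_left_mono) auto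
    finally show ?case by simp
  qed
qed

text \<open>The reciprocal of n / \<open>trunc_mean n\<close> is the average of \<open>a\<close>
  over the first n indices, and averages of a decreasing sequence decrease.\<close>

lemma frac_mono:
  assumes "1 \<le> m" "m \<le> n"
  shows "real m / trunc_mean m \<le> real n / trunc_mean n"
proof -
  have 1: "real m * a m \<le> trunc_mean m" by (rule mult_tail_le)
  have "real m * trunc_mean n \<le> real m * (trunc_mean m + real (n - m) * a m)"
    using trunc_mean_add[of m "n - m"] assms by (intro mult_left_mono) auto
  also have "\<dots> = real m * trunc_mean m + real (n - m) * (real m * a m)" by (simp add: algebra_simps)
  also have "\<dots> \<le> real m * trunc_mean m + real (n - m) * trunc_mean m"
    using 1 by (intro add_left_mono mult_left_mono) auto
  also have "\<dots> = real n * trunc_mean m" using assms by (simp add: algebra_simps of_nat_diff)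
  finally show ?thesis using trunc_mean_ge_1[of m] trunc_mean_ge_1[of n] assms by (simp add: field_simps)
qed

lemma dscale_mono: "j \<le> k \<Longrightarrow> dscale j \<le> dscale k"
  unfolding dscale_def using frac_mono[of "2^j" "2^k"] by simp

lemma dscale_at_top: "filterlim dscale at_top sequentially"
proof -
  from dscale_growth obtain k0 where k0: "\<And>k. k \<ge> k0 \<Longrightarrow> dscale (Suc k) \<ge> 3 / 2 * dscale k"
    unfolding eventually_sequentially by blast
  have "dscale (n + k0) \<ge> (3 / 2) ^ n * dscale k0" for n
  proof (induction n)
    case (Suc n)
    have "(3 / 2) ^ Suc n * dscale k0 = 3 / 2 * ((3 / 2) ^ n * dscale k0)" by simp
    also have "\<dots> \<le> 3 / 2 * dscale (n + k0)" using Suc by (intro mult_left_mono) simp_all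
    also have "\<dots> \<le> dscale (Suc n + k0)" using k0[of "n + k0"] by simp
    finally show ?case .
  qed simp
  note grow = this
  have "filterlim (\<lambda>n. (3 / 2) ^ n * dscale k0) at_top sequentially"
    by (subst mult.commute, rule filterlim_tendsto_pos_mult_at_top[OF tendsto_const dscale_pos(1)])
      (rule filterlim_at_infinity_imp_filterlim_at_top[OF filterlim_realpow_sequentially_gt1], auto)
  then have "filterlim (\<lambda>n. dscale (n + k0)) at_top sequentially"
    using grow by (intro filterlim_at_top_mono[where g="\<lambda>n. dscale (n + k0)"]) auto
  then show ?thesis
    unfolding filterlim_at_top
    using eventually_sequentially_seg[of "\<lambda>n. _ \<le> dscale n" k0] by blast
qed

text \<open>The share of the covariances in the same relative variance: a pair at distance d
  contributes \<open>\<psi> d\<close>, and about \<alpha>(2^k) return times are summed.\<close>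

definition psi_ratio :: "nat \<Rightarrow> real" where
  "psi_ratio k = psi_sum (nat \<lfloor>dscale k\<rfloor>) / dscale k"

lemma psi_sum_nonneg: "0 \<le> psi_sum n"
  unfolding psi_sum_def using psi_nonneg by (intro sum_nonneg) auto

lemma psi_sum_mono: "m \<le> n \<Longrightarrow> psi_sum m \<le> psi_sum n"
  unfolding psi_sum_def using psi_nonneg by (intro sum_mono2) auto

lemma psi_ratio_nonneg: "0 \<le> psi_ratio k"
  unfolding psi_ratio_def using psi_sum_nonneg by simp

text \<open>The distances d between consecutive scales contribute \<open>e k\<close>, and these are
  disjoint parts of the convergent series of \<psi>(d) / d. The older part of the sum is damped by
  the geometric growth of \<open>dscale\<close>, so \<open>summable_contraction\<close>
  applies.\<close>

lemma summable_psi_ratio: "summable psi_ratio"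
proof -
  define n where "n k = nat \<lfloor>dscale k\<rfloor>" for k
  define e where "e k = (\<Sum>d\<in>{Suc (n k)..n (Suc k)}. \<psi> d / real d)" for k
  have n_mono: "n j \<le> n k" if "j \<le> k" for j k
    unfolding n_def using dscale_mono[OF that] by (intro nat_mono floor_mono)
  have e_nonneg: "0 \<le> e k" for k unfolding e_def using psi_nonneg by (intro sum_nonneg) auto
  have "(\<Sum>k<m. e k) \<le> (\<Sum>d. \<psi> (Suc d) / real (Suc d))" for m
  proof -
    have "(\<Sum>k<m. e k) = (\<Sum>d\<in>{Suc (n 0)..n m}. \<psi> d / real d)"
    proof (induction m)
      case (Suc m)
      have "{Suc (n 0)..n (Suc m)} = {Suc (n 0)..n m} \<union> {Suc (n m)..n (Suc m)}"
        using n_mono[of 0 m] n_mono[of m "Suc m"] by auto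
      then show ?case using Suc by (simp add: e_def sum.union_disjoint)
    qed simp
    also have "\<dots> \<le> (\<Sum>d\<in>{Suc 0..n m}. \<psi> d / real d)"
      using psi_nonneg by (intro sum_mono2) auto
    also have "\<dots> = (\<Sum>d<n m. \<psi> (Suc d) / real (Suc d))"
      by (rule sum.reindex_bij_witness[where j="\<lambda>d. d - 1" and i=Suc]) auto
    also have "\<dots> \<le> (\<Sum>d. \<psi> (Suc d) / real (Suc d))"
      using psi_nonneg by (intro sum_le_suminf psi_summable) auto
    finally show ?thesis .
  qed
  then have e_sum: "summable e" using e_nonneg by (intro summableI_nonneg_bounded) auto
  show ?thesis
  proof (rule summable_contraction[where c="2/3" and e = e])
    show "\<forall>\<^sub>F k in sequentially. psi_ratio (Suc k) \<le> 2 / 3 * psi_ratio k + e k"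
      using dscale_growth
    proof eventually_elim
      case (elim k)
      have "{1..n (Suc k)} = {1..n k} \<union> {Suc (n k)..n (Suc k)}"
        using n_mono[of k "Suc k"] by auto
      then have "psi_sum (n (Suc k)) = psi_sum (n k) + (\<Sum>d\<in>{Suc (n k)..n (Suc k)}. \<psi> d)"
        by (simp add: psi_sum_def sum.union_disjoint)
      also have "(\<Sum>d\<in>{Suc (n k)..n (Suc k)}. \<psi> d) \<le> (\<Sum>d\<in>{Suc (n k)..n (Suc k)}. dscale (Suc k) * (\<psi> d / real d))"
      proof (intro sum_mono)
        fix d assume d: "d \<in> {Suc (n k)..n (Suc k)}"
        then have "real d \<le> real (n (Suc k))" by simp
        also have "\<dots> \<le> dscale (Suc k)" unfolding n_def by simp
        finally have "\<psi> d * real d \<le> \<psi> d * dscale (Suc k)" using psi_nonneg by (intro mult_left_mono) auto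
        then show "\<psi> d \<le> dscale (Suc k) * (\<psi> d / real d)" using d by (simp add: field_simps)
      qed
      also have "\<dots> = dscale (Suc k) * e k" by (simp add: e_def sum_distrib_left)
      finally have "psi_sum (n (Suc k)) \<le> psi_sum (n k) + dscale (Suc k) * e k" by simp
      then have "psi_ratio (Suc k) \<le> psi_sum (n k) / dscale (Suc k) + e k"
        unfolding psi_ratio_def n_def[symmetric]  by (simp add: field_simps)
      also have "psi_sum (n k) / dscale (Suc k) \<le> psi_sum (n k) / (3 / 2 * dscale k)"
        using elim dscale_pos(1) psi_sum_nonneg by (intro divide_left_mono) auto
      also have "\<dots> = 2 / 3 * psi_ratio k" by (simp add: psi_ratio_def n_def)
      finally show ?case by simp
    qed
  qed (use psi_ratio_nonneg e_nonneg e_sum in auto)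
qed

end

section \<open>Block sums of a mixing sequence\<close>

lemma real_min_eq_sum: "real (min n t) = (\<Sum>u<t. of_bool (u < n))"
proof -
  have "(\<Sum>u<t. of_bool (u < n)) = (\<Sum>u\<in>{..<t} \<inter> {u. u < n}. (1::real))"
    by (simp add: of_bool_def sum.If_cases)
  also have "{..<t} \<inter> {u. u < n} = {..<min n t}" by auto
  finally show ?thesis by simp
qed

lemma real_min_square_eq_sum: "(real (min n t))\<^sup>2 = (\<Sum>u<t. (2 * real u + 1) * of_bool (u < n))"
proof (induction t)
  case (Suc t)
  show ?case
  proof (cases "t < n")
    case True
    then have "min n (Suc t) = Suc t" "min n t = t" by auto
    then show ?thesis using Suc True by (simp add: power2_eq_square algebra_simps)
  next
    case False
    then have "min n (Suc t) = min n t" by auto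
    then show ?thesis using Suc False by simp
  qed
qed simp

text \<open>The bound \<open>mix\<close> is asked for gaps n \<ge> 1, because the coefficient for
  gap 0 may be infinite. Its multiplied form covers null events as well.\<close>

locale mixing_sequence = prob_space P + tail_sequence a \<psi>
  for P :: "'a measure" and a \<psi> :: "nat \<Rightarrow> real" +
  fixes X :: "nat \<Rightarrow> 'a \<Rightarrow> nat"
  assumes X_meas [measurable]: "\<And>n. X n \<in> measurable P (count_space UNIV)"
    and tail: "\<And>n j. prob {x\<in>space P. X n x > j} = a j"
    and mix: "\<And>n j B C. 1 \<le> n \<Longrightarrow> B \<in> generated_events P (count_space UNIV) X {0..j} \<Longrightarrow>
      C \<in> generated_events P (count_space UNIV) X {j + n..} \<Longrightarrow>
      prob (B \<inter> C) \<le> (1 + \<psi> n) * (prob B * prob C)"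
begin

text \<open>The \<sigma>-field of \<open>generated_events\<close> packaged as a measure, so that
  events of the past and of the future can be treated by the measurability rules.\<close>

definition history :: "nat set \<Rightarrow> 'a measure" where
  "history I = sigma (space P) {X i -` A \<inter> space P | i A. i \<in> I \<and> A \<in> sets (count_space UNIV)}"

lemma space_history [simp]: "space (history I) = space P"
  unfolding history_def by (rule space_measure_of) auto

lemma sets_history: "sets (history I) = generated_events P (count_space UNIV) X I"
  unfolding history_def generated_events_def by (rule sets_measure_of) auto

lemma X_history: "i \<in> I \<Longrightarrow> X i \<in> measurable (history I) (count_space UNIV)"
proof (rule measurableI)
  show "i \<in> I \<Longrightarrow> X i -` A \<inter> space (history I) \<in> sets (history I)" for A
    unfolding space_history unfolding sets_history generated_events_def
    by (rule sigma_sets.Basic) auto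
qed auto

lemma mix_history:
  assumes "1 \<le> n" "B \<in> sets (history {0..j})" "C \<in> sets (history {j + n..})"
  shows "prob (B \<inter> C) \<le> (1 + \<psi> n) * (prob B * prob C)"
  using mix assms unfolding sets_history by blast

definition block_sum :: "nat \<Rightarrow> nat set \<Rightarrow> 'a \<Rightarrow> real" where
  "block_sum t I x = (\<Sum>i\<in>I. real (min (X i x) t))"

lemma block_sum_history: "I \<subseteq> J \<Longrightarrow> block_sum t I \<in> borel_measurable (history J)"
proof -
  assume "I \<subseteq> J"
  then have [measurable]: "i \<in> I \<Longrightarrow> X i \<in> measurable (history J) (count_space UNIV)" for i
    using X_history[of i J] by blast
  show ?thesis unfolding block_sum_def by measurable
qed

lemma block_sum_meas [measurable]: "block_sum t I \<in> borel_measurable P"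
  unfolding block_sum_def by measurable

lemma block_sum_nonneg: "0 \<le> block_sum t I x"
  unfolding block_sum_def by (intro sum_nonneg) auto

lemma trunc_integrable [simp]:
  "integrable P (\<lambda>x. real (min (X i x) t))"
  "integrable P (\<lambda>x. real (min (X i x) t) * real (min (X j x) t))"
proof -
  show "integrable P (\<lambda>x. real (min (X i x) t))"
    by (rule integrable_const_bound[where B="real t"]) auto
  show "integrable P (\<lambda>x. real (min (X i x) t) * real (min (X j x) t))"
  proof (rule integrable_const_bound[where B="real t * real t"])
    show "AE x in P. norm (real (min (X i x) t) * real (min (X j x) t)) \<le> real t * real t"
      by (intro AE_I2) (auto simp: abs_mult intro!: mult_mono)
  qed measurable
qed

lemma expectation_of_bool:
  assumes [measurable]: "Measurable.pred P Q"
  shows "expectation (\<lambda>x. of_bool (Q x)) = prob {x\<in>space P. Q x}"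
    "integrable P (\<lambda>x. of_bool (Q x) :: real)"
proof -
  have "expectation (\<lambda>x. of_bool (Q x)) = expectation (indicator {x\<in>space P. Q x})"
    by (rule Bochner_Integration.integral_cong) (auto simp: indicator_def)
  also have "\<dots> = prob {x\<in>space P. Q x}" by (simp add: Int_absorb2 Int_absorb1 subset_eq)
  finally show "expectation (\<lambda>x. of_bool (Q x)) = prob {x\<in>space P. Q x}" .
  show "integrable P (\<lambda>x. of_bool (Q x) :: real)"
    by (rule integrable_const_bound[where B=1]) auto
qed

lemma expectation_trunc: "expectation (\<lambda>x. real (min (X i x) t)) = trunc_mean t"
  unfolding real_min_eq_sum trunc_mean_def
  by (subst Bochner_Integration.integral_sum) (auto simp: expectation_of_bool tail)

lemma expectation_trunc_square: "expectation (\<lambda>x. (real (min (X i x) t))\<^sup>2) = trunc_square t"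
  unfolding real_min_square_eq_sum trunc_square_def
  by (subst Bochner_Integration.integral_sum) (auto simp: expectation_of_bool tail)

lemma tail_event_history: "i \<in> I \<Longrightarrow> {x\<in>space P. X i x > u} \<in> sets (history I)"
proof -
  assume "i \<in> I"
  have "{x\<in>space P. X i x > u} = X i -` {u<..} \<inter> space (history I)" by auto
  then show ?thesis using measurable_sets[OF X_history[OF \<open>i \<in> I\<close>], of "{u<..}"] by simp
qed

lemma joint_tail:
  assumes "i < j"
  shows "prob {x\<in>space P. X i x > u \<and> X j x > v} \<le> (1 + \<psi> (j - i)) * (a u * a v)"
proof -
  have "{x\<in>space P. X i x > u \<and> X j x > v} = {x\<in>space P. X i x > u} \<inter> {x\<in>space P. X j x > v}" by auto
  moreover have "prob \<dots> \<le> (1 + \<psi> (j - i)) * (prob {x\<in>space P. X i x > u} * prob {x\<in>space P. X j x > v})"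
    using assms by (intro mix_history[where j=i] tail_event_history) auto
  ultimately show ?thesis by (simp add: tail)
qed

text \<open>Both truncated variables are expanded into sums of tail indicators; mixing is applied to
  each pair of tails, and the double sum factors again.\<close>

lemma expectation_trunc_product:
  assumes "i < j"
  shows "expectation (\<lambda>x. real (min (X i x) t) * real (min (X j x) t)) \<le> (1 + \<psi> (j - i)) * (trunc_mean t)\<^sup>2"
proof -
  have "expectation (\<lambda>x. real (min (X i x) t) * real (min (X j x) t))
    = expectation (\<lambda>x. \<Sum>u<t. \<Sum>v<t. of_bool (u < X i x \<and> v < X j x))"
    unfolding real_min_eq_sum sum_product by (simp add: of_bool_conj)
  also have "\<dots> = (\<Sum>u<t. \<Sum>v<t. prob {x\<in>space P. u < X i x \<and> v < X j x})"
    by (subst Bochner_Integration.integral_sum, simp add: expectation_of_bool del: sum_of_bool_eq)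
      (simp add: expectation_of_bool Bochner_Integration.integral_sum del: sum_of_bool_eq)
  also have "\<dots> \<le> (\<Sum>u<t. \<Sum>v<t. (1 + \<psi> (j - i)) * (a u * a v))"
    by (intro sum_mono joint_tail assms)
  also have "\<dots> = (1 + \<psi> (j - i)) * (trunc_mean t)\<^sup>2"
    unfolding trunc_mean_def power2_eq_square sum_product by (simp only: sum_distrib_left)
  finally show ?thesis .
qed

lemma expectation_block_sum:
  "expectation (block_sum t {s..<s + m}) = real m * trunc_mean t"
  unfolding block_sum_def by (subst Bochner_Integration.integral_sum) (simp_all only: expectation_trunc trunc_integrable, simp)

text \<open>For fixed i the other indices lie to the left or to the right of i, and each side meets
  every distance at most once. This gives two copies of \<open>psi_sum m\<close>; the diagonal gives
  \<open>trunc_square\<close>.\<close>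

lemma second_moment_block_sum:
  "expectation (\<lambda>x. (block_sum t {s..<s + m} x)\<^sup>2)
    \<le> real m * trunc_square t + (real m * trunc_mean t)\<^sup>2 + 2 * real m * psi_sum m * (trunc_mean t)\<^sup>2"
proof -
  let ?I = "{s..<s + m}"
  let ?e = "\<lambda>i j. expectation (\<lambda>x. real (min (X i x) t) * real (min (X j x) t))"
  let ?L = "(trunc_mean t)\<^sup>2"
  have "expectation (\<lambda>x. (block_sum t ?I x)\<^sup>2) = (\<Sum>i\<in>?I. \<Sum>j\<in>?I. ?e i j)"
    unfolding block_sum_def power2_eq_square sum_product
    by (subst Bochner_Integration.integral_sum)
      (auto simp: Bochner_Integration.integral_sum intro!: Bochner_Integration.integrable_sum simp del: of_nat_min)
  also have "\<dots> \<le> (\<Sum>i\<in>?I. trunc_square t + real m * ?L + 2 * psi_sum m * ?L)"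
  proof (rule sum_mono)
    fix i assume i: "i \<in> ?I"
    have "?I = {s..<i} \<union> {i} \<union> {Suc i..<s + m}" using i by auto
    then have "(\<Sum>j\<in>?I. ?e i j) = (\<Sum>j\<in>{s..<i} \<union> {i} \<union> {Suc i..<s + m}. ?e i j)" by simp
    also have "\<dots> = (\<Sum>j\<in>{s..<i}. ?e i j) + ?e i i + (\<Sum>j\<in>{Suc i..<s + m}. ?e i j)"
      by (subst sum.union_disjoint, simp, simp, force)+ simp
    also have "?e i i = trunc_square t"
      using expectation_trunc_square[of i t] by (simp add: power2_eq_square)
    also have "(\<Sum>j\<in>{s..<i}. ?e i j) \<le> (\<Sum>j\<in>{s..<i}. (1 + \<psi> (i - j)) * ?L)"
      using expectation_trunc_product[of _ i t] by (intro sum_mono) (simp add: mult.commute)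
    also have "\<dots> = real (i - s) * ?L + (\<Sum>j\<in>{s..<i}. \<psi> (i - j)) * ?L"
      by (simp add: sum_distrib_right[symmetric] sum.distrib algebra_simps)
    also have "(\<Sum>j\<in>{s..<i}. \<psi> (i - j)) = (\<Sum>d\<in>{1..i - s}. \<psi> d)"
      by (rule sum.reindex_bij_witness[where i="\<lambda>d. i - d" and j="\<lambda>j. i - j"]) auto
    also have "(\<Sum>j\<in>{Suc i..<s + m}. ?e i j) \<le> (\<Sum>j\<in>{Suc i..<s + m}. (1 + \<psi> (j - i)) * ?L)"
      using expectation_trunc_product[of i _ t] by (intro sum_mono) simp
    also have "\<dots> = real (s + m - Suc i) * ?L + (\<Sum>j\<in>{Suc i..<s + m}. \<psi> (j - i)) * ?L"
      by (simp add: sum_distrib_right[symmetric] sum.distrib algebra_simps)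
    also have "(\<Sum>j\<in>{Suc i..<s + m}. \<psi> (j - i)) = (\<Sum>d\<in>{1..s + m - Suc i}. \<psi> d)"
      by (rule sum.reindex_bij_witness[where i="\<lambda>d. i + d" and j="\<lambda>j. j - i"]) auto
    finally have "(\<Sum>j\<in>?I. ?e i j) \<le> real (i - s) * ?L + psi_sum (i - s) * ?L + trunc_square t
      + (real (s + m - Suc i) * ?L + psi_sum (s + m - Suc i) * ?L)"
      by (simp add: psi_sum_def)
    moreover have "psi_sum (i - s) * ?L \<le> psi_sum m * ?L" "psi_sum (s + m - Suc i) * ?L \<le> psi_sum m * ?L"
      using i by (auto intro!: mult_right_mono psi_sum_mono)
    moreover have "real (i - s) * ?L + real (s + m - Suc i) * ?L \<le> real m * ?L"
      unfolding distrib_right[symmetric] using i by (intro mult_right_mono) auto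
    ultimately show "(\<Sum>j\<in>?I. ?e i j) \<le> trunc_square t + real m * ?L + 2 * psi_sum m * ?L" by linarith
  qed
  also have "\<dots> = real m * trunc_square t + (real m * trunc_mean t)\<^sup>2 + 2 * real m * psi_sum m * ?L"
    by (simp add: power2_eq_square algebra_simps)
  finally show ?thesis .
qed

lemma block_sum_bound: "block_sum t {s..<s + m} x \<le> real m * real t"
proof -
  have "block_sum t {s..<s + m} x \<le> (\<Sum>i\<in>{s..<s + m}. real t)"
    unfolding block_sum_def by (intro sum_mono) simp
  then show ?thesis by simp
qed

text \<open>Chebyshev. The mean is known exactly, so the squared mean in the second moment bound
  cancels and only diagonal and covariance terms remain.\<close>

lemma block_sum_deviation:
  assumes d: "d > 0"
  shows "prob {x\<in>space P. \<bar>block_sum t {s..<s + m} x - real m * trunc_mean t\<bar> \<ge> d}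
    \<le> (real m * trunc_square t + 2 * real m * psi_sum m * (trunc_mean t)\<^sup>2) / d\<^sup>2"
proof -
  let ?S = "block_sum t {s..<s + m}"
  have int: "integrable P ?S"
    by (rule integrable_const_bound[where B="real m * real t"])
      (auto simp: block_sum_nonneg block_sum_bound)
  have int2: "integrable P (\<lambda>x. (?S x)\<^sup>2)"
    by (rule integrable_const_bound[where B="(real m * real t)\<^sup>2"])
      (auto simp: block_sum_nonneg block_sum_bound intro!: AE_I2 power_mono)
  have "variance ?S = expectation (\<lambda>x. (?S x)\<^sup>2) - (expectation ?S)\<^sup>2"
    by (rule variance_eq[OF int int2])
  also have "\<dots> \<le> real m * trunc_square t + 2 * real m * psi_sum m * (trunc_mean t)\<^sup>2"
    using second_moment_block_sum[of t s m] unfolding expectation_block_sum by simp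
  finally have v: "variance ?S \<le> real m * trunc_square t + 2 * real m * psi_sum m * (trunc_mean t)\<^sup>2" .
  have "prob {x\<in>space P. d \<le> \<bar>?S x - expectation ?S\<bar>} \<le> variance ?S / d\<^sup>2"
    by (rule Chebyshev_inequality) (use d int2 in auto)
  also have "\<dots> \<le> (real m * trunc_square t + 2 * real m * psi_sum m * (trunc_mean t)\<^sup>2) / d\<^sup>2"
    by (intro divide_right_mono v) simp
  finally show ?thesis unfolding expectation_block_sum .
qed

text \<open>As in the Hoffmann-Joergensen inequality: after the first passage of the level \<open>u\<close> the sum has to climb
  by \<open>u\<close> once more.\<close>

lemma block_sum_large:
  assumes u: "u > 0"
  shows "prob {x\<in>space P. block_sum t {s..<s + m} x \<ge> 2 * u + real t}
    \<le> (1 + \<psi> 1) * (prob {x\<in>space P. block_sum t {s..<s + m} x \<ge> u})\<^sup>2"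
proof -
  let ?I = "{s..<s + m}"
  let ?U = "{x\<in>space P. block_sum t ?I x \<ge> u}"
  \<comment> \<open>\<open>F e\<close>: the level u is first passed at index e. The remainder in
    \<open>R e\<close> starts at e + 1, so mixing is used with gap 1.\<close>
  define F where "F e = {x\<in>space P. block_sum t {s..<e} x < u \<and> u \<le> block_sum t {s..<Suc e} x}" for e
  define R where "R e = {x\<in>space P. u \<le> block_sum t {Suc e..<s + m} x}" for e
  have mono: "block_sum t A x \<le> block_sum t B x" if "A \<subseteq> B" "finite B" for A B x
    unfolding block_sum_def using that by (intro sum_mono2) auto
  have [measurable]: "F e \<in> sets P" "R e \<in> sets P" for e unfolding F_def R_def by measurable
  have F_hist: "F e \<in> sets (history {0..e})" for e
  proof -
    have [measurable]: "block_sum t {s..<e} \<in> borel_measurable (history {0..e})"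
        "block_sum t {s..<Suc e} \<in> borel_measurable (history {0..e})"
      by (auto intro!: block_sum_history)
    have "{x\<in>space (history {0..e}). block_sum t {s..<e} x < u \<and> u \<le> block_sum t {s..<Suc e} x} \<in> sets (history {0..e})"
      by measurable
    then show ?thesis by (simp add: F_def)
  qed
  have R_hist: "R e \<in> sets (history {e + 1..})" for e
  proof -
    have [measurable]: "block_sum t {Suc e..<s + m} \<in> borel_measurable (history {e + 1..})"
      by (auto intro!: block_sum_history)
    have "{x\<in>space (history {e + 1..}). u \<le> block_sum t {Suc e..<s + m} x} \<in> sets (history {e + 1..})"
      by measurable
    then show ?thesis by (simp add: R_def)
  qed
  have disj: "disjoint_family_on F ?I"
  proof -
    have "F e \<inter> F e' = {}" if "e < e'" for e e'
    proof -
      have "block_sum t {s..<Suc e} x \<le> block_sum t {s..<e'} x" for x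
        using that by (intro mono) auto
      then show ?thesis unfolding F_def by (auto simp: not_le[symmetric] intro: order_trans)
    qed
    then show ?thesis unfolding disjoint_family_on_def by (metis Int_commute linorder_neqE_nat)
  qed
  have "{x\<in>space P. block_sum t ?I x \<ge> 2 * u + real t} \<subseteq> (\<Union>e\<in>?I. F e \<inter> R e)"
  proof
    fix x assume x: "x \<in> {x\<in>space P. block_sum t ?I x \<ge> 2 * u + real t}"
    let ?Q = "\<lambda>k. u \<le> block_sum t {s..<s + k} x"
    define k where "k = (LEAST k. ?Q k)"
    have Q: "?Q m" using x u by simp
    have k: "?Q k" unfolding k_def using Q by (rule LeastI)
    have km: "k \<le> m" unfolding k_def using Q by (rule Least_le)
    have "\<not> ?Q 0" using u by (simp add: block_sum_def)
    then obtain k' where k': "k = Suc k'" using k by (cases k) auto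
    have "\<not> ?Q k'" using not_less_Least[of k' ?Q] k' unfolding k_def by simp
    then have F: "x \<in> F (s + k')" using k k' x by (simp add: F_def)
    \<comment> \<open>The sum is below u before the passage and gains at most t at the passage; of 2
      u + t at least u is left for the remainder.\<close>
    have "block_sum t ?I x = block_sum t {s..<s + k'} x + real (min (X (s + k') x) t) + block_sum t {Suc (s + k')..<s + m} x"
    proof -
      have "block_sum t ?I x = block_sum t {s..<s + k'} x + block_sum t {s + k'..<s + m} x"
        unfolding block_sum_def using km k' by (intro sum.atLeastLessThan_concat[symmetric]) auto
      moreover have "block_sum t {s + k'..<s + m} x = real (min (X (s + k') x) t) + block_sum t {Suc (s + k')..<s + m} x"
        unfolding block_sum_def using km k' by (intro sum.atLeast_Suc_lessThan) auto
      ultimately show ?thesis by simp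
    qed
    moreover have "real (min (X (s + k') x) t) \<le> real t" by simp
    moreover have "2 * u + real t \<le> block_sum t ?I x" using x by simp
    ultimately have "u \<le> block_sum t {Suc (s + k')..<s + m} x"
      using \<open>\<not> ?Q k'\<close> by linarith
    then have "x \<in> R (s + k')" using x by (simp add: R_def)
    then show "x \<in> (\<Union>e\<in>?I. F e \<inter> R e)" using F km k' by (intro UN_I[of "s + k'"]) auto
  qed
  then have "prob {x\<in>space P. block_sum t ?I x \<ge> 2 * u + real t} \<le> prob (\<Union>e\<in>?I. F e \<inter> R e)"
    by (intro finite_measure_mono) auto
  also have "\<dots> \<le> (\<Sum>e\<in>?I. prob (F e \<inter> R e))"
    by (rule finite_measure_subadditive_finite) auto
  also have "\<dots> \<le> (\<Sum>e\<in>?I. (1 + \<psi> 1) * (prob (F e) * prob ?U))"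
  proof (rule sum_mono)
    fix e assume e: "e \<in> ?I"
    have "R e \<subseteq> ?U" using mono[of "{Suc e..<s + m}" ?I] e unfolding R_def by (auto intro: order_trans)
    then have "prob (R e) \<le> prob ?U" by (intro finite_measure_mono) auto
    moreover have "prob (F e \<inter> R e) \<le> (1 + \<psi> 1) * (prob (F e) * prob (R e))"
      by (rule mix_history[OF _ F_hist R_hist]) simp
    ultimately show "prob (F e \<inter> R e) \<le> (1 + \<psi> 1) * (prob (F e) * prob ?U)"
      using psi_nonneg[of 1] by (smt (verit) measure_nonneg mult_left_mono)
  qed
  \<comment> \<open>First passages at different indices exclude each other, so their probabilities
    add up to that of one event and the number of indices does not enter.\<close>
  also have "\<dots> = (1 + \<psi> 1) * (prob (\<Union>e\<in>?I. F e) * prob ?U)"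
    by (subst finite_measure_finite_Union) (use disj in \<open>auto simp: sum_distrib_left sum_distrib_right\<close>)
  also have "\<dots> \<le> (1 + \<psi> 1) * (prob ?U * prob ?U)"
  proof -
    have "(\<Union>e\<in>?I. F e) \<subseteq> ?U"
    proof
      fix x assume "x \<in> (\<Union>e\<in>?I. F e)"
      then obtain e where "e \<in> ?I" "x \<in> F e" by blast
      then show "x \<in> ?U" using mono[of "{s..<Suc e}" ?I x] by (auto simp: F_def)
    qed
    then have "prob (\<Union>e\<in>?I. F e) \<le> prob ?U" by (intro finite_measure_mono) auto
    then show ?thesis using psi_nonneg[of 1] by (intro mult_left_mono mult_right_mono) auto
  qed
  finally show ?thesis by (simp add: power2_eq_square)
qed

end

section \<open>The law of large numbers for trimmed sums\<close>

text \<open>The inserted 0 provides a maximum for n = 0. The subtraction on \<open>nat\<close> is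
  exact by \<open>trimmed_sum_plus_Max\<close>.\<close>

definition trimmed_sum :: "(nat \<Rightarrow> nat) \<Rightarrow> nat \<Rightarrow> nat" where
  "trimmed_sum x n = (\<Sum>i<n. x i) - Max (insert 0 (x ` {..<n}))"

lemma trimmed_sum_plus_Max: "trimmed_sum x n + Max (insert 0 (x ` {..<n})) = (\<Sum>i<n. x i)"
proof -
  have "Max (insert 0 (x ` {..<n})) \<le> (\<Sum>i<n. x i)"
    by (subst Max_le_iff) (auto intro: member_le_sum)
  then show ?thesis unfolding trimmed_sum_def by simp
qed

text \<open>One more term increases the sum by x n, and the maximum by no more than that.\<close>

lemma trimmed_sum_mono: "m \<le> n \<Longrightarrow> trimmed_sum x m \<le> trimmed_sum x n"
proof (rule lift_Suc_mono_le[of "trimmed_sum x"])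
  fix n
  have "insert 0 (x ` {..<Suc n}) = insert (x n) (insert 0 (x ` {..<n}))"
    by (auto simp: lessThan_Suc)
  then have "Max (insert 0 (x ` {..<Suc n})) = max (x n) (Max (insert 0 (x ` {..<n})))"
    by (simp del: insert_commute)
  then show "trimmed_sum x n \<le> trimmed_sum x (Suc n)"
    using trimmed_sum_plus_Max[of x n] trimmed_sum_plus_Max[of x "Suc n"] by simp
qed

text \<open>If one term exceeds t, it is the maximum: truncation counts it as t and trimming as 0,
  while the other terms agree. If none does, the two sums differ by the maximum, which is at most
  t.\<close>

lemma trimmed_sum_truncation:
  assumes one: "\<And>i j. i < j \<Longrightarrow> j < n \<Longrightarrow> \<not> (x i > t \<and> x j > t)"
  shows "(\<Sum>i<n. min (x i) t) \<le> trimmed_sum x n + t" "trimmed_sum x n \<le> (\<Sum>i<n. min (x i) t)"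
proof -
  let ?M = "Max (insert 0 (x ` {..<n}))"
  note eq = trimmed_sum_plus_Max[of x n]
  have "(\<Sum>i<n. min (x i) t) \<le> trimmed_sum x n + t \<and> trimmed_sum x n \<le> (\<Sum>i<n. min (x i) t)"
  proof (cases "\<exists>i0<n. x i0 > t")
    case True
    then obtain i0 where i0: "i0 < n" "x i0 > t" by blast
    have small: "x i \<le> t" if "i < n" "i \<noteq> i0" for i
      using one[of i i0] one[of i0 i] that i0 by (metis linorder_neqE_nat not_le)
    have "?M = x i0"
    proof (rule Max_eqI)
      fix y assume "y \<in> insert 0 (x ` {..<n})"
      then show "y \<le> x i0" using small i0 by (auto, metis less_imp_le order.trans order_refl)
    qed (use i0 in auto)
    moreover have "(\<Sum>i<n. x i) = x i0 + (\<Sum>i\<in>{..<n} - {i0}. x i)"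
      using i0 by (subst sum.remove[of _ i0]) auto
    moreover have "(\<Sum>i<n. min (x i) t) = t + (\<Sum>i\<in>{..<n} - {i0}. min (x i) t)"
      using i0 by (subst sum.remove[of _ i0]) auto
    moreover have "(\<Sum>i\<in>{..<n} - {i0}. min (x i) t) = (\<Sum>i\<in>{..<n} - {i0}. x i)"
      using small by (intro sum.cong) (auto simp: min_def)
    ultimately show ?thesis using eq by simp
  next
    case False
    then have small: "x i \<le> t" if "i < n" for i
      using that not_less by blast
    then have "(\<Sum>i<n. min (x i) t) = (\<Sum>i<n. x i)"
      by (intro sum.cong) auto
    moreover have "?M \<le> t" using small by (subst Max_le_iff) auto
    ultimately show ?thesis using eq by linarith
  qed
  then show "(\<Sum>i<n. min (x i) t) \<le> trimmed_sum x n + t" "trimmed_sum x n \<le> (\<Sum>i<n. min (x i) t)" by auto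
qed

text \<open>For the deviations of the blocks: d is the typical bound, B the crude bound for the one
  block that may violate it.\<close>

lemma sum_le_one_exception:
  fixes f :: "'b \<Rightarrow> real"
  assumes A: "finite A" and B: "\<And>i. i \<in> A \<Longrightarrow> f i \<le> B" and "0 \<le> B" "0 \<le> d"
    and one: "\<And>i j. i \<in> A \<Longrightarrow> j \<in> A \<Longrightarrow> i \<noteq> j \<Longrightarrow> f i < d \<or> f j < d"
  shows "sum f A \<le> real (card A) * d + B"
proof (cases "\<exists>i\<in>A. f i \<ge> d")
  case True
  then obtain i where i: "i \<in> A" "f i \<ge> d" by blast
  have "sum f A = f i + sum f (A - {i})" using A i by (simp add: sum.remove)
  also have "sum f (A - {i}) \<le> (\<Sum>j\<in>A - {i}. d)"
    using one[OF _ i(1)] i by (intro sum_mono) force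
  also have "\<dots> \<le> real (card A) * d"
    using A \<open>0 \<le> d\<close> by (simp add: mult_right_mono card_mono)
  finally show ?thesis using B[OF i(1)] by simp
next
  case False
  then have "sum f A \<le> (\<Sum>j\<in>A. d)" by (intro sum_mono) force
  then show ?thesis using \<open>0 \<le> B\<close> by simp
qed

lemma (in prob_space) prob_pairs_le:
  assumes A: "\<And>i. i < n \<Longrightarrow> A i \<in> events"
    and c: "\<And>i j. i < j \<Longrightarrow> j < n \<Longrightarrow> prob (A i \<inter> A j) \<le> c" and "0 \<le> c"
  shows "prob (\<Union>(i, j)\<in>{(i, j). i < j \<and> j < n}. A i \<inter> A j) \<le> (real n)\<^sup>2 * c"
proof -
  let ?K = "{(i, j). i < j \<and> j < n}"
  have sub: "?K \<subseteq> {..<n} \<times> {..<n}" by auto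
  then have fin: "finite ?K" by (rule finite_subset) auto
  have "prob (\<Union>(i, j)\<in>?K. A i \<inter> A j) \<le> (\<Sum>(i, j)\<in>?K. prob (A i \<inter> A j))"
    using A fin unfolding case_prod_beta by (intro finite_measure_subadditive_finite) auto
  also have "\<dots> \<le> (\<Sum>(i, j)\<in>?K. c)" using c by (intro sum_mono) auto
  also have "\<dots> = real (card ?K) * c" by (simp add: case_prod_beta)
  also have "\<dots> \<le> (real n)\<^sup>2 * c"
    using card_mono[OF _ sub] \<open>0 \<le> c\<close>
    by (intro mult_right_mono) (simp_all add: power2_eq_square flip: of_nat_mult)
  finally show ?thesis .
qed

section \<open>Analytic estimates for the block scheme\<close>

context tail_sequence
begin

definition block_length :: "nat \<Rightarrow> nat \<Rightarrow> nat" where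
  "block_length r k = nat \<lfloor>dscale k / 2 ^ r\<rfloor>"

lemma block_length_le: "real (block_length r k) \<le> dscale k / 2 ^ r"
  unfolding block_length_def by (simp add: le_floor_iff[symmetric])

lemma block_length_gt: "dscale k / 2 ^ r < real (block_length r k) + 1"
  unfolding block_length_def using floor_correct[of "dscale k / 2 ^ r"] by simp

lemma dscale_trunc_mean: "dscale k * trunc_mean (2 ^ k) = 2 ^ k"
  unfolding dscale_def by simp

lemma block_mean_le: "real (block_length r k) * trunc_mean (2 ^ (k - r)) \<le> 2 ^ k / 2 ^ r"
proof -
  have "real (block_length r k) * trunc_mean (2 ^ (k - r)) \<le> dscale k / 2 ^ r * trunc_mean (2 ^ k)"
    by (intro mult_mono block_length_le trunc_mean_mono power_increasing) (auto simp: less_imp_le)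
  then show ?thesis using dscale_trunc_mean[of k] by simp
qed

text \<open>The left side is the Chebyshev bound for one block. Replacing its length and truncated
  means by their values at scale k, \<open>dscale_trunc_mean\<close> turns both terms into 4^k times
  a ratio. The threshold 2^k / 4^r is chosen so that 3 * 2^r blocks within it are off by at most 3
  units 2^k / 2^r in total.\<close>

lemma deviation_bound:
  assumes "r \<le> k"
  shows "(real (block_length r k) * trunc_square (2 ^ (k - r))
      + 2 * real (block_length r k) * psi_sum (block_length r k) * (trunc_mean (2 ^ (k - r)))\<^sup>2) / (2 ^ k / 4 ^ r)\<^sup>2
    \<le> 16 ^ r * (square_ratio (k - r) + 2 * psi_ratio k)"
proof -
  define m where "m = block_length r k"
  have ds: "dscale k / 2 ^ r \<le> dscale k"
    using divide_left_mono[of 1 "2 ^ r" "dscale k"] by simp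
  have m: "real m \<le> dscale k" unfolding m_def using block_length_le[of r k] ds by linarith
  have m': "m \<le> nat \<lfloor>dscale k\<rfloor>" using m by (simp add: le_nat_iff le_floor_iff)
  have L: "trunc_mean (2 ^ (k - r)) \<le> trunc_mean (2 ^ k)"
    by (intro trunc_mean_mono power_increasing) auto
  have "real m * trunc_square (2 ^ (k - r)) \<le> dscale k * (square_ratio (k - r) * (2 ^ k * trunc_mean (2 ^ k)))"
  proof (intro mult_mono m)
    have "trunc_square (2 ^ (k - r)) = square_ratio (k - r) * (2 ^ (k - r) * trunc_mean (2 ^ (k - r)))"
      unfolding square_ratio_def by simp
    also have "\<dots> \<le> square_ratio (k - r) * (2 ^ k * trunc_mean (2 ^ k))"
      using L by (intro mult_left_mono mult_mono square_ratio_nonneg power_increasing) (auto simp: less_imp_le)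
    finally show "trunc_square (2 ^ (k - r)) \<le> square_ratio (k - r) * (2 ^ k * trunc_mean (2 ^ k))" .
  qed (auto simp: trunc_square_nonneg)
  also have "\<dots> = 2 ^ k * (dscale k * trunc_mean (2 ^ k)) * square_ratio (k - r)" by simp
  finally have 1: "real m * trunc_square (2 ^ (k - r)) \<le> 4 ^ k * square_ratio (k - r)"
    unfolding dscale_trunc_mean by (simp flip: power_mult_distrib)
  have "2 * real m * psi_sum m * (trunc_mean (2 ^ (k - r)))\<^sup>2
      \<le> 2 * dscale k * psi_sum (nat \<lfloor>dscale k\<rfloor>) * (trunc_mean (2 ^ k))\<^sup>2"
    using m m' L by (intro mult_mono power_mono psi_sum_mono) (auto simp: psi_sum_nonneg less_imp_le)
  also have "\<dots> = 2 * psi_ratio k * (dscale k * trunc_mean (2 ^ k))\<^sup>2"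
    unfolding psi_ratio_def by (simp add: power2_eq_square)
  also have "\<dots> = 4 ^ k * (2 * psi_ratio k)"
    unfolding dscale_trunc_mean by (simp add: power2_eq_square flip: power_mult_distrib)
  finally have 2: "2 * real m * psi_sum m * (trunc_mean (2 ^ (k - r)))\<^sup>2 \<le> 4 ^ k * (2 * psi_ratio k)" .
  have sq: "(2 ^ k / 4 ^ r)\<^sup>2 = (4 ^ k / 16 ^ r :: real)"
    by (simp add: power_divide power2_eq_square flip: power_mult_distrib)
  have "(real m * trunc_square (2 ^ (k - r)) + 2 * real m * psi_sum m * (trunc_mean (2 ^ (k - r)))\<^sup>2) / (2 ^ k / 4 ^ r)\<^sup>2
    \<le> (4 ^ k * square_ratio (k - r) + 4 ^ k * (2 * psi_ratio k)) / (2 ^ k / 4 ^ r)\<^sup>2"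
    using 1 2 by (intro divide_right_mono add_mono) auto
  also have "\<dots> = 16 ^ r * (square_ratio (k - r) + 2 * psi_ratio k)"
    unfolding sq by (simp add: field_simps)
  finally show ?thesis unfolding m_def .
qed

text \<open>This is the expected number of exceedances in all blocks. Lowering the level from 2^k to
  2^(k-r) costs the factor 2^r.\<close>

lemma exceedance_bound:
  assumes "r \<le> k"
  shows "real (3 * 2 ^ r * block_length r k) * a (2 ^ (k - r)) \<le> 3 * 2 ^ r * tail_ratio (k - r)"
proof -
  have k: "2 ^ k = 2 ^ r * (2 ^ (k - r) :: real)" using assms by (simp flip: power_add)
  have "real (3 * 2 ^ r * block_length r k) = 3 * 2 ^ r * real (block_length r k)" by simp
  also have "\<dots> \<le> 3 * 2 ^ r * (dscale k / 2 ^ r)" by (intro mult_left_mono block_length_le) auto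
  also have "\<dots> = 3 * (2 ^ k / trunc_mean (2 ^ k))" by (simp add: dscale_def)
  also have "\<dots> \<le> 3 * (2 ^ k / trunc_mean (2 ^ (k - r)))"
    by (intro mult_left_mono divide_left_mono trunc_mean_mono power_increasing) auto
  finally have "real (3 * 2 ^ r * block_length r k) * a (2 ^ (k - r))
    \<le> 3 * (2 ^ k / trunc_mean (2 ^ (k - r))) * a (2 ^ (k - r))"
    using a_nonneg by (intro mult_right_mono) auto
  also have "\<dots> = 3 * 2 ^ r * tail_ratio (k - r)" unfolding tail_ratio_def k by simp
  finally show ?thesis .
qed

lemma trunc_mean_slow: "(\<lambda>k. trunc_mean (2 ^ k) / trunc_mean (2 ^ (k + r))) \<longlonglongrightarrow> 1"
proof (induction r)
  case (Suc r)
  have "(\<lambda>k. trunc_mean (2 ^ k) / trunc_mean (2 ^ Suc k)) \<longlonglongrightarrow> 1"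
  proof (rule tendsto_sandwich)
    show "\<forall>\<^sub>F k in sequentially. 1 / (1 + tail_ratio k) \<le> trunc_mean (2 ^ k) / trunc_mean (2 ^ Suc k)"
    proof (intro always_eventually allI)
      fix k
      have "0 < 1 + tail_ratio k" using tail_ratio_nonneg[of k] by simp
      then show "1 / (1 + tail_ratio k) \<le> trunc_mean (2 ^ k) / trunc_mean (2 ^ Suc k)"
        using trunc_mean_double[of k] trunc_mean_pow(1)[of "Suc k"]
        by (simp add: field_simps del: power_Suc)
    qed
    show "\<forall>\<^sub>F k in sequentially. trunc_mean (2 ^ k) / trunc_mean (2 ^ Suc k) \<le> 1"
      using trunc_mean_mono[of "2^_" "2^Suc _"] trunc_mean_pow(1)[of "Suc _"]
      by (intro always_eventually allI) (simp add: divide_le_eq)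
    show "(\<lambda>k. 1 / (1 + tail_ratio k)) \<longlonglongrightarrow> 1"
      using tendsto_divide[OF tendsto_const tendsto_add[OF tendsto_const tail_ratio_lim], of 1 1] by simp
  qed simp
  from tendsto_mult[OF Suc LIMSEQ_ignore_initial_segment[OF this, of r]]
  have "(\<lambda>k. trunc_mean (2 ^ k) / trunc_mean (2 ^ (k + r)) *
    (trunc_mean (2 ^ (k + r)) / trunc_mean (2 ^ Suc (k + r)))) \<longlonglongrightarrow> 1" by simp
  then show ?case by (simp del: power_Suc)
qed simp

text \<open>Two losses occur, the rounding of the block length and the lower truncation level. The
  first vanishes because \<open>dscale\<close> diverges, the second by slow variation.\<close>

lemma block_mean_lim:
  assumes "\<epsilon> > 0"
  shows "\<forall>\<^sub>F k in sequentially. real (block_length r k) * trunc_mean (2 ^ (k - r)) \<ge> (1 - \<epsilon>) * (2 ^ k / 2 ^ r)"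
proof -
  have "(\<lambda>k. 2 ^ r * inverse (dscale k)) \<longlonglongrightarrow> 2 ^ r * 0"
    by (intro tendsto_mult tendsto_const tendsto_inverse_0_at_top dscale_at_top)
  then have "(\<lambda>k. 1 - 2 ^ r * inverse (dscale (k + r))) \<longlonglongrightarrow> 1 - 0"
    by (intro tendsto_diff tendsto_const LIMSEQ_ignore_initial_segment) simp
  from tendsto_mult[OF this trunc_mean_slow[of r]]
  have "(\<lambda>k. (1 - 2 ^ r * inverse (dscale (k + r))) * (trunc_mean (2 ^ k) / trunc_mean (2 ^ (k + r)))) \<longlonglongrightarrow> 1"
    by simp
  then have "\<forall>\<^sub>F k in sequentially. (1 - 2 ^ r * inverse (dscale (k + r))) * (trunc_mean (2 ^ k) / trunc_mean (2 ^ (k + r))) > 1 - \<epsilon>"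
    by (rule order_tendstoD) (use assms in simp)
  \<comment> \<open>At k + r the subtraction of r is exact; the shift is undone at the end.\<close>
  then have "\<forall>\<^sub>F k in sequentially. real (block_length r (k + r)) * trunc_mean (2 ^ (k + r - r)) \<ge> (1 - \<epsilon>) * (2 ^ (k + r) / 2 ^ r)"
  proof eventually_elim
    case (elim k)
    have "(1 - \<epsilon>) * (2 ^ (k + r) / 2 ^ r) \<le> (1 - 2 ^ r * inverse (dscale (k + r))) *
      (trunc_mean (2 ^ k) / trunc_mean (2 ^ (k + r))) * (2 ^ (k + r) / 2 ^ r)"
      using elim by (intro mult_right_mono) auto
    also have "\<dots> = (1 - 2 ^ r * inverse (dscale (k + r))) * (dscale (k + r) / 2 ^ r) * trunc_mean (2 ^ k)"
      unfolding dscale_def by simp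
    also have "(1 - 2 ^ r * inverse (dscale (k + r))) * (dscale (k + r) / 2 ^ r) = dscale (k + r) / 2 ^ r - 1"
      using dscale_pos(3)[of "k + r"] by (simp add: field_simps)
    also have "(dscale (k + r) / 2 ^ r - 1) * trunc_mean (2 ^ k) \<le> real (block_length r (k + r)) * trunc_mean (2 ^ k)"
      using block_length_gt[of "k + r" r] by (intro mult_right_mono) (auto simp: less_imp_le)
    finally show ?case by simp
  qed
  then show ?thesis
    using eventually_sequentially_seg[of "\<lambda>k. real (block_length r k) * trunc_mean (2 ^ (k - r)) \<ge> (1 - \<epsilon>) * (2 ^ k / 2 ^ r)" r]
    by blast
qed

lemma block_length_pos: "\<forall>\<^sub>F k in sequentially. block_length r k \<ge> 1"
proof -
  have "\<forall>\<^sub>F k in sequentially. dscale k \<ge> 2 ^ r"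
    using dscale_at_top unfolding filterlim_at_top by blast
  then show ?thesis
    by eventually_elim (simp add: block_length_def le_nat_iff le_floor_iff)
qed

end

section \<open>Exceptional events and Borel-Cantelli\<close>

context mixing_sequence
begin

definition deviates :: "nat \<Rightarrow> nat \<Rightarrow> nat \<Rightarrow> 'a set" where
  "deviates r k b = {x\<in>space P.
     \<bar>block_sum (2 ^ (k - r)) {b * block_length r k..<b * block_length r k + block_length r k} x
       - real (block_length r k) * trunc_mean (2 ^ (k - r))\<bar> \<ge> 2 ^ k / 4 ^ r}"

definition exceeds :: "nat \<Rightarrow> nat \<Rightarrow> nat \<Rightarrow> 'a set" where
  "exceeds r k i = {x\<in>space P. X i x > 2 ^ (k - r)}"

text \<open>The level is that of \<open>block_sum_large\<close> with u = 2 w, where w = 2^k / 2^r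
  bounds the block mean. For r \<le> k the truncation level equals w, so the level is 5 w.\<close>

definition climbs :: "nat \<Rightarrow> nat \<Rightarrow> nat \<Rightarrow> 'a set" where
  "climbs r k b = {x\<in>space P.
     block_sum (2 ^ (k - r)) {b * block_length r k..<b * block_length r k + block_length r k} x
       \<ge> 2 * (2 * (2 ^ k / 2 ^ r)) + real (2 ^ (k - r))}"

text \<open>Off this event at most one block deviates, no block sum reaches the level in
  \<open>climbs\<close>, and truncation affects at most one return time.\<close>

definition exceptional :: "nat \<Rightarrow> nat \<Rightarrow> 'a set" where
  "exceptional r k =
     (\<Union>(b, b')\<in>{(b, b'). b < b' \<and> b' < 3 * 2 ^ r}. deviates r k b \<inter> deviates r k b')
     \<union> (\<Union>b\<in>{..<3 * 2 ^ r}. climbs r k b)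
     \<union> (\<Union>(i, j)\<in>{(i, j). i < j \<and> j < 3 * 2 ^ r * block_length r k}. exceeds r k i \<inter> exceeds r k j)"

lemma exceptional_sets [measurable]:
  "deviates r k b \<in> events" "climbs r k b \<in> events" "exceeds r k i \<in> events" "exceptional r k \<in> events"
proof -
  show [measurable]: "deviates r k b \<in> events" for b unfolding deviates_def by measurable
  show [measurable]: "climbs r k b \<in> events" for b unfolding climbs_def by measurable
  show [measurable]: "exceeds r k i \<in> events" for i unfolding exceeds_def by measurable
  show "exceptional r k \<in> events" unfolding exceptional_def
    by (intro sets.Un sets.countable_UN'' countableI_type) auto
qed

lemma deviates_history:
  assumes "{b * block_length r k..<b * block_length r k + block_length r k} \<subseteq> J"
  shows "deviates r k b \<in> sets (history J)"
proof -
  note [measurable] = block_sum_history[OF assms]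
  have "{x\<in>space (history J).
     \<bar>block_sum (2 ^ (k - r)) {b * block_length r k..<b * block_length r k + block_length r k} x
       - real (block_length r k) * trunc_mean (2 ^ (k - r))\<bar> \<ge> 2 ^ k / 4 ^ r} \<in> sets (history J)"
    by measurable
  then show ?thesis by (simp add: deviates_def)
qed

lemma prob_deviates:
  assumes "r \<le> k"
  shows "prob (deviates r k b) \<le> 16 ^ r * (square_ratio (k - r) + 2 * psi_ratio k)"
  unfolding deviates_def
  by (rule order_trans[OF block_sum_deviation deviation_bound[OF assms]]) simp

text \<open>All three parts are quadratic in a square-summable quantity. In the first constant, 9 *
  4^r accounts for the pairs of blocks and another 9 * 4^r bounds the number of single blocks; 1024
  = 4 * 16^2 also contains the factor 16^r of \<beta>.\<close>

lemma prob_exceptional: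
  assumes "r \<le> k" "block_length r k \<ge> 1"
  shows "prob (exceptional r k) \<le> (1 + \<psi> 1) *
    (18 * 1024 ^ r * (square_ratio (k - r) + 2 * psi_ratio k)\<^sup>2 + 9 * 4 ^ r * (tail_ratio (k - r))\<^sup>2)"
proof -
  define \<beta> where "\<beta> = 16 ^ r * (square_ratio (k - r) + 2 * psi_ratio k)"
  define m where "m = block_length r k"
  define w :: real where "w = 2 ^ k / 2 ^ r"
  let ?q = "3 * 2 ^ r :: nat"
  have m: "m \<ge> 1" using assms(2) by (simp add: m_def)
  have \<psi>: "0 \<le> 1 + \<psi> 1" using psi_nonneg[of 1] by simp
  have \<beta>: "prob (deviates r k b) \<le> \<beta>" for b
    unfolding \<beta>_def by (rule prob_deviates[OF assms(1)])
  then have \<beta>0: "0 \<le> \<beta>" using measure_nonneg order_trans by blast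
  have "prob (deviates r k b \<inter> deviates r k b') \<le> (1 + \<psi> 1) * \<beta>\<^sup>2" if "b < b'" for b b'
  proof -
    \<comment> \<open>Block b ends before block b' begins. Its last index, a genuine one since m
      \<ge> 1, separates past from future.\<close>
    have "b * m + m \<le> b' * m" using mult_le_mono1[of "Suc b" b' m] that by simp
    then have "prob (deviates r k b \<inter> deviates r k b') \<le> (1 + \<psi> 1) * (prob (deviates r k b) * prob (deviates r k b'))"
      using m unfolding m_def
      by (intro mix_history[where j="b * block_length r k + block_length r k - 1"] deviates_history) auto
    also have "\<dots> \<le> (1 + \<psi> 1) * (\<beta> * \<beta>)"
      by (intro mult_left_mono mult_mono \<beta> \<beta>0 \<psi>) auto
    finally show ?thesis by (simp add: power2_eq_square)
  qed
  then have 1: "prob (\<Union>(b, b')\<in>{(b, b'). b < b' \<and> b' < ?q}. deviates r k b \<inter> deviates r k b') \<le> (real ?q)\<^sup>2 * ((1 + \<psi> 1) * \<beta>\<^sup>2)"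
    using \<psi> by (intro prob_pairs_le) auto
  have climb: "prob (climbs r k b) \<le> (1 + \<psi> 1) * \<beta>\<^sup>2" for b
  proof -
    let ?S = "block_sum (2 ^ (k - r)) {b * m..<b * m + m}"
    have start: "prob (climbs r k b) \<le> (1 + \<psi> 1) * (prob {x\<in>space P. ?S x \<ge> 2 * w})\<^sup>2"
      unfolding climbs_def m_def[symmetric] w_def[symmetric] by (rule block_sum_large) (simp add: w_def)
    \<comment> \<open>The mean is at most w, and so is the threshold in \<open>deviates\<close>;
      hence a sum of at least 2 w deviates.\<close>
    have "prob {x\<in>space P. ?S x \<ge> 2 * w} \<le> prob (deviates r k b)"
    proof (rule finite_measure_mono)
      have "(2::real) ^ k / 4 ^ r \<le> w" unfolding w_def by (intro divide_left_mono power_mono) auto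
      moreover have "real m * trunc_mean (2 ^ (k - r)) \<le> w" unfolding m_def w_def by (rule block_mean_le)
      ultimately show "{x\<in>space P. ?S x \<ge> 2 * w} \<subseteq> deviates r k b"
        unfolding deviates_def m_def[symmetric] by auto
    qed simp
    also have "\<dots> \<le> \<beta>" by (rule \<beta>)
    finally have "(prob {x\<in>space P. ?S x \<ge> 2 * w})\<^sup>2 \<le> \<beta>\<^sup>2"
      by (intro power_mono) auto
    from mult_left_mono[OF this \<psi>] start show ?thesis by (rule order_trans[rotated])
  qed
  have "prob (\<Union>b\<in>{..<?q}. climbs r k b) \<le> (\<Sum>b<?q. prob (climbs r k b))"
    by (intro finite_measure_subadditive_finite) auto
  also have "\<dots> \<le> (\<Sum>b<?q. (1 + \<psi> 1) * \<beta>\<^sup>2)" by (intro sum_mono climb)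
  finally have 2: "prob (\<Union>b\<in>{..<?q}. climbs r k b) \<le> real ?q * ((1 + \<psi> 1) * \<beta>\<^sup>2)" by simp
  have "prob (exceeds r k i \<inter> exceeds r k j) \<le> (1 + \<psi> 1) * (a (2 ^ (k - r)))\<^sup>2" if "i < j" for i j
  proof -
    have "prob (exceeds r k i \<inter> exceeds r k j) \<le> (1 + \<psi> 1) * (prob (exceeds r k i) * prob (exceeds r k j))"
      unfolding exceeds_def using that by (intro mix_history[where j=i] tail_event_history) auto
    then show ?thesis unfolding exceeds_def tail by (simp add: power2_eq_square)
  qed
  then have "prob (\<Union>(i, j)\<in>{(i, j). i < j \<and> j < ?q * m}. exceeds r k i \<inter> exceeds r k j)
      \<le> (real (?q * m))\<^sup>2 * ((1 + \<psi> 1) * (a (2 ^ (k - r)))\<^sup>2)"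
    using \<psi> by (intro prob_pairs_le) auto
  also have "\<dots> = (1 + \<psi> 1) * (real (?q * m) * a (2 ^ (k - r)))\<^sup>2" by (simp add: power_mult_distrib)
  also have "\<dots> \<le> (1 + \<psi> 1) * (3 * 2 ^ r * tail_ratio (k - r))\<^sup>2"
    unfolding m_def using a_nonneg by (intro mult_left_mono power_mono exceedance_bound assms \<psi>) auto
  also have "\<dots> = (1 + \<psi> 1) * (9 * 4 ^ r * (tail_ratio (k - r))\<^sup>2)"
    by (simp add: power_mult_distrib power2_eq_square flip: power_mult_distrib)
  finally have 3: "prob (\<Union>(i, j)\<in>{(i, j). i < j \<and> j < ?q * m}. exceeds r k i \<inter> exceeds r k j)
    \<le> (1 + \<psi> 1) * (9 * 4 ^ r * (tail_ratio (k - r))\<^sup>2)" .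
  have "prob (exceptional r k) \<le> prob (\<Union>(b, b')\<in>{(b, b'). b < b' \<and> b' < ?q}. deviates r k b \<inter> deviates r k b')
     + prob (\<Union>b\<in>{..<?q}. climbs r k b)
     + prob (\<Union>(i, j)\<in>{(i, j). i < j \<and> j < ?q * m}. exceeds r k i \<inter> exceeds r k j)"
    unfolding exceptional_def m_def[symmetric]
    by (intro order_trans[OF measure_Un_le] add_mono sets.Un sets.countable_UN'' countableI_type order_refl) auto
  also have "\<dots> \<le> (real ?q)\<^sup>2 * ((1 + \<psi> 1) * \<beta>\<^sup>2) + real ?q * ((1 + \<psi> 1) * \<beta>\<^sup>2)
     + (1 + \<psi> 1) * (9 * 4 ^ r * (tail_ratio (k - r))\<^sup>2)"
    by (intro add_mono 1 2 3)
  also have "\<dots> \<le> (1 + \<psi> 1) * (18 * 4 ^ r * \<beta>\<^sup>2 + 9 * 4 ^ r * (tail_ratio (k - r))\<^sup>2)"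
  proof -
    have "real ?q \<le> (real ?q)\<^sup>2" using of_nat_mono[of 1 ?q] by (intro self_le_power) (simp_all add: Suc_le_eq)
    moreover have "(real ?q)\<^sup>2 = 9 * 4 ^ r"
      by (simp add: power_mult_distrib power2_eq_square flip: power_mult_distrib)
    ultimately have "((real ?q)\<^sup>2 + real ?q) * \<beta>\<^sup>2 \<le> 18 * 4 ^ r * \<beta>\<^sup>2"
      by (intro mult_right_mono) auto
    from mult_left_mono[OF this \<psi>] show ?thesis by (simp add: algebra_simps)
  qed
  also have "18 * 4 ^ r * \<beta>\<^sup>2 = 18 * 1024 ^ r * (square_ratio (k - r) + 2 * psi_ratio k)\<^sup>2"
  proof -
    have "(4::real) ^ r * (16 ^ r * 16 ^ r) = 1024 ^ r" by (simp flip: power_mult_distrib)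
    then show ?thesis unfolding \<beta>_def by (simp add: power2_eq_square mult_ac)
  qed
  finally show ?thesis .
qed

text \<open>For fixed r the powers 1024^r and 4^r are constants, so square-summability of the three
  ratios suffices.\<close>

lemma summable_exceptional: "summable (\<lambda>k. prob (exceptional r k))"
proof (rule summable_comparison_test_ev)
  let ?f = "\<lambda>k. (1 + \<psi> 1) * (18 * 1024 ^ r * (square_ratio (k - r) + 2 * psi_ratio k)\<^sup>2
      + 9 * 4 ^ r * (tail_ratio (k - r))\<^sup>2)"
  show "\<forall>\<^sub>F k in sequentially. norm (prob (exceptional r k)) \<le> ?f k"
    using block_length_pos[of r] eventually_ge_at_top[of r]
    by eventually_elim (use prob_exceptional in auto)
  have shift: "summable (\<lambda>k. (u (k - r))\<^sup>2)" if "summable (\<lambda>k. (u k)\<^sup>2)" for u :: "nat \<Rightarrow> real"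
    using that summable_iff_shift[of "\<lambda>k. (u (k - r))\<^sup>2" r] by simp
  have "summable (\<lambda>k. (square_ratio (k - r) + 2 * psi_ratio k)\<^sup>2)"
  proof (rule summable_comparison_test)
    show "summable (\<lambda>k. 2 * (square_ratio (k - r))\<^sup>2 + 8 * (psi_ratio k)\<^sup>2)"
      by (intro summable_add summable_mult shift summable_square_ratio summable_power2
          summable_psi_ratio psi_ratio_nonneg)
    show "\<exists>N. \<forall>n\<ge>N. norm ((square_ratio (n - r) + 2 * psi_ratio n)\<^sup>2)
        \<le> 2 * (square_ratio (n - r))\<^sup>2 + 8 * (psi_ratio n)\<^sup>2"
    proof (intro exI allI impI)
      fix n
      show "norm ((square_ratio (n - r) + 2 * psi_ratio n)\<^sup>2) \<le> 2 * (square_ratio (n - r))\<^sup>2 + 8 * (psi_ratio n)\<^sup>2"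
        using zero_le_power2[of "square_ratio (n - r) - 2 * psi_ratio n"]
        unfolding power2_diff power2_sum real_norm_def
        using square_ratio_nonneg[of "n - r"] psi_ratio_nonneg[of n] by (simp add: power_mult_distrib)
    qed
  qed
  then show "summable ?f"
    by (intro summable_mult summable_add shift summable_tail_ratio)
qed

text \<open>The constant 10 in units w = 2^k / 2^r: 3 for the blocks that do not deviate, 5 for the
  one that may, 1 for the drift of the block means, 1 for trimming versus truncation. As it does not
  depend on r, the relative error is of order 2^(-r).\<close>

lemma trimmed_sum_law:
  "AE x in P. \<forall>\<^sub>F k in sequentially. \<forall>p\<le>3 * 2 ^ r.
     \<bar>real (trimmed_sum (\<lambda>i. X i x) (p * block_length r k)) - real p * (2 ^ k / 2 ^ r)\<bar> \<le> 10 * (2 ^ k / 2 ^ r)"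
proof -
  have "AE x in P. \<forall>\<^sub>F k in sequentially. x \<in> space P - exceptional r k"
    by (rule borel_cantelli_AE1) (auto simp: summable_exceptional emeasure_eq_measure)
  then show ?thesis
  proof eventually_elim
    case (elim x)
    \<comment> \<open>With relative drift 1 / (3 * 2^r), the drift over at most 3 * 2^r blocks adds
      up to one unit.\<close>
    have "\<forall>\<^sub>F k in sequentially. real (block_length r k) * trunc_mean (2 ^ (k - r)) \<ge> (1 - 1 / (3 * 2 ^ r)) * (2 ^ k / 2 ^ r)"
      by (rule block_mean_lim) simp
    then show ?case using elim eventually_ge_at_top[of r]
    proof eventually_elim
      case (elim k)
      show ?case
      proof (intro allI impI)
        fix p :: nat assume p: "p \<le> 3 * 2 ^ r"
        define m where "m = block_length r k"
        define w :: real where "w = 2 ^ k / 2 ^ r"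
        define t :: nat where "t = 2 ^ (k - r)"
        define L where "L = trunc_mean t"
        define d :: real where "d = 2 ^ k / 4 ^ r"
        have w0: "w \<ge> 0" "d \<ge> 0" by (auto simp: w_def d_def)
        have tw: "real t = w" unfolding t_def w_def of_nat_power of_nat_numeral using elim(3) by (intro power_diff) auto
        have mL: "real m * L \<le> w" unfolding m_def L_def w_def t_def by (rule block_mean_le)
        have mL': "real m * L \<ge> (1 - 1 / (3 * 2 ^ r)) * w" using elim(1) by (simp add: m_def L_def w_def t_def)
        let ?S = "\<lambda>b. block_sum t {b * m..<b * m + m} x"
        have "0 \<le> real m * L" by (simp add: L_def t_def less_imp_le)
        have xP: "x \<in> space P" using elim(2) by simp
        have S: "?S b \<le> 5 * w" if "b < 3 * 2 ^ r" for b
        proof -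
          have "x \<notin> climbs r k b" using elim(2) that unfolding exceptional_def by blast
          then show ?thesis using xP tw unfolding climbs_def m_def t_def w_def by auto
        qed
        have "(\<Sum>b<p. \<bar>?S b - real m * L\<bar>) \<le> real (card {..<p}) * d + 5 * w"
        proof (rule sum_le_one_exception)
          fix b assume "b \<in> {..<p}"
          then have "?S b \<le> 5 * w" using S[of b] p by simp
          \<comment> \<open>Block sum and mean lie in [0, 5 w] and [0, w], so even the deviating
            block is off by at most 5 w.\<close>
          then show "\<bar>?S b - real m * L\<bar> \<le> 5 * w"
            using mL w0 block_sum_nonneg[of t "{b * m..<b * m + m}" x] \<open>0 \<le> real m * L\<close>
            unfolding abs_le_iff by linarith
        next
          fix b b' assume b: "b \<in> {..<p}" "b' \<in> {..<p}" "b \<noteq> b'"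
          have "x \<notin> deviates r k b \<inter> deviates r k b'" if "b < b'" "b' < 3 * 2 ^ r" for b b'
            using elim(2) that unfolding exceptional_def by blast
          then have "\<not> (x \<in> deviates r k b \<and> x \<in> deviates r k b')"
            using b p by (metis IntI lessThan_iff linorder_neqE_nat order_less_le_trans)
          then show "\<bar>?S b - real m * L\<bar> < d \<or> \<bar>?S b' - real m * L\<bar> < d"
            using xP unfolding deviates_def m_def t_def L_def d_def by auto
        qed (use w0 in auto)
        also have "real (card {..<p}) * d \<le> 3 * w"
        proof -
          have "real p \<le> 3 * 2 ^ r" using p by (metis of_nat_le_iff of_nat_mult of_nat_numeral of_nat_power)
          then have "real p * d \<le> 3 * 2 ^ r * d" using w0 by (intro mult_right_mono) auto
          also have "\<dots> = 3 * w" unfolding d_def w_def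
            by (simp add: field_simps) (simp flip: power_mult_distrib)
          finally show ?thesis by simp
        qed
        finally have dev: "(\<Sum>b<p. \<bar>?S b - real m * L\<bar>) \<le> 8 * w" by simp
        have tot: "(\<Sum>i<p * m. real (min (X i x) t)) = (\<Sum>b<p. ?S b)"
          unfolding block_sum_def by (rule sum.nat_group[symmetric])
        have "\<bar>(\<Sum>b<p. ?S b) - real p * (real m * L)\<bar> = \<bar>\<Sum>b<p. (?S b - real m * L)\<bar>"
          by (simp add: sum_subtractf)
        also have "\<dots> \<le> 8 * w" using sum_abs dev by (rule order_trans)
        finally have A: "\<bar>(\<Sum>b<p. ?S b) - real p * (real m * L)\<bar> \<le> 8 * w" .
        have B: "\<bar>real p * (real m * L) - real p * w\<bar> \<le> w"
        proof -
          have "\<bar>real p * (real m * L) - real p * w\<bar> = real p * (w - real m * L)"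
            using mL by (simp add: abs_mult right_diff_distrib[symmetric])
          also have "\<dots> \<le> (3 * 2 ^ r) * (1 / (3 * 2 ^ r) * w)"
          proof (rule mult_mono)
            show "real p \<le> 3 * 2 ^ r" using p by (metis of_nat_le_iff of_nat_mult of_nat_numeral of_nat_power)
            show "w - real m * L \<le> 1 / (3 * 2 ^ r) * w" using mL' by (simp add: algebra_simps)
          qed (use mL in auto)
          finally show ?thesis by simp
        qed
        have trim: "(\<Sum>i<p * m. min (X i x) t) \<le> trimmed_sum (\<lambda>i. X i x) (p * m) + t"
          "trimmed_sum (\<lambda>i. X i x) (p * m) \<le> (\<Sum>i<p * m. min (X i x) t)"
        proof -
          have "\<not> (X i x > t \<and> X j x > t)" if "i < j" "j < p * m" for i j
          proof -
            have "j < 3 * 2 ^ r * m" using that(2) mult_le_mono1[OF p, of m] by (rule less_le_trans)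
            then have "x \<notin> exceeds r k i \<inter> exceeds r k j"
              using elim(2) that(1) unfolding exceptional_def m_def by blast
            then show ?thesis using xP by (auto simp: exceeds_def t_def)
          qed
          from trimmed_sum_truncation[where x="\<lambda>i. X i x", OF this]
          show "(\<Sum>i<p * m. min (X i x) t) \<le> trimmed_sum (\<lambda>i. X i x) (p * m) + t"
            "trimmed_sum (\<lambda>i. X i x) (p * m) \<le> (\<Sum>i<p * m. min (X i x) t)" by auto
        qed
        have "real (\<Sum>i<p * m. min (X i x) t) = (\<Sum>b<p. ?S b)" using tot by simp
        then have "(\<Sum>b<p. ?S b) \<le> real (trimmed_sum (\<lambda>i. X i x) (p * m)) + w"
          "real (trimmed_sum (\<lambda>i. X i x) (p * m)) \<le> (\<Sum>b<p. ?S b)"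
          using trim tw by (metis of_nat_add of_nat_le_iff)+
        then show "\<bar>real (trimmed_sum (\<lambda>i. X i x) (p * block_length r k)) - real p * (2 ^ k / 2 ^ r)\<bar> \<le> 10 * (2 ^ k / 2 ^ r)"
          using A B unfolding m_def[symmetric] w_def[symmetric] by linarith
      qed
    qed
  qed
qed

end

section \<open>Counting visits\<close>

context tail_sequence
begin

text \<open>\<open>C N\<close> will be the number of visits before time N + m(N);
  \<open>lower\<close> and \<open>upper\<close> say that it inverts the trimmed sum. The law is
  available at multiples of the block length, so N is squeezed between the trimmed sums at two
  nearby multiples.\<close>

lemma count_asymptotics:
  fixes x :: "nat \<Rightarrow> nat" and C :: "nat \<Rightarrow> real"
  assumes law: "\<And>r. \<forall>\<^sub>F k in sequentially. \<forall>p\<le>3 * 2 ^ r.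
     \<bar>real (trimmed_sum x (p * block_length r k)) - real p * (2 ^ k / 2 ^ r)\<bar> \<le> 10 * (2 ^ k / 2 ^ r)"
    and lower: "\<And>n N. trimmed_sum x n < N \<Longrightarrow> real n \<le> C N"
    and upper: "\<And>n N. trimmed_sum x n > N \<Longrightarrow> C N \<le> real n"
  shows "(\<lambda>N. C N / (real N / trunc_mean N)) \<longlonglongrightarrow> 1"
proof (rule LIMSEQ_I)
  fix e :: real assume e: "e > 0"
  \<comment> \<open>The final bounds are (1 + h)^2 and (1 - h)^2, which for h \<le> 1 are within 3 h
    < e of 1.\<close>
  define h where "h = min (e / 4) 1"
  have h: "0 < h" "h \<le> 1" "4 * h \<le> e" using e by (auto simp: h_def)
  obtain r0 :: nat where r0: "12 / h < 2 ^ r0"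
    using real_arch_pow[of 2 "12 / h"] by auto
  \<comment> \<open>2^r \<ge> 16 leaves room for the shifts below: z - 11 is a true difference and z
    + 12 does not exceed 3 * 2^r.\<close>
  define r where "r = max r0 4"
  have "(2::real) ^ r0 \<le> 2 ^ r" by (rule power_increasing) (auto simp: r_def)
  then have rh: "12 / 2 ^ r \<le> h" 
  proof -
    have "12 / h < 2 ^ r" using r0 \<open>2 ^ r0 \<le> 2 ^ r\<close> by (rule less_le_trans)
    then show ?thesis using h(1) by (simp add: field_simps)
  qed
  have r16: "(16::real) \<le> 2 ^ r" using power_increasing[of 4 r "2::real"] by (simp add: r_def)
  have "\<forall>\<^sub>F k in sequentially. dscale k \<ge> 2 ^ r / h"
    using dscale_at_top unfolding filterlim_at_top by blast
  moreover have "\<forall>\<^sub>F k in sequentially. tail_ratio k < h"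
    using tail_ratio_lim h(1) by (rule order_tendstoD)
  ultimately have "\<forall>\<^sub>F k in sequentially. dscale k \<ge> 2 ^ r / h \<and> tail_ratio k < h \<and>
     (\<forall>p\<le>3 * 2 ^ r. \<bar>real (trimmed_sum x (p * block_length r k)) - real p * (2 ^ k / 2 ^ r)\<bar> \<le> 10 * (2 ^ k / 2 ^ r))"
    using law[of r] by eventually_elim blast
  then obtain k0 where k0: "\<And>k. k \<ge> k0 \<Longrightarrow> dscale k \<ge> 2 ^ r / h"
    "\<And>k. k \<ge> k0 \<Longrightarrow> tail_ratio k < h"
    "\<And>k p. k \<ge> k0 \<Longrightarrow> p \<le> 3 * 2 ^ r \<Longrightarrow>
      \<bar>real (trimmed_sum x (p * block_length r k)) - real p * (2 ^ k / 2 ^ r)\<bar> \<le> 10 * (2 ^ k / 2 ^ r)"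
    unfolding eventually_sequentially by blast
  show "\<exists>N0. \<forall>N\<ge>N0. norm (C N / (real N / trunc_mean N) - 1) < e"
  proof (intro exI[of _ "2 ^ k0"] allI impI)
    fix N :: nat assume N: "2 ^ k0 \<le> N"
    then have "N \<ge> 1" by (metis one_le_numeral one_le_power order_trans)
    then obtain k where k: "2 ^ k \<le> N" "N < 2 ^ Suc k"
      using ex_power_ivl1[of 2 N] by auto
    have "(2::nat) ^ k0 < 2 ^ Suc k" using N k by simp
    then have "k \<ge> k0" by (metis less_Suc_eq_le one_less_numeral_iff power_strict_increasing_iff semiring_norm(76))
    note k0 = k0[OF \<open>k \<ge> k0\<close>]
    define w :: real where "w = 2 ^ k / 2 ^ r"
    \<comment> \<open>\<open>s\<close> is N in units w and \<open>D\<close> the block length before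
      rounding. Their product N / L(2^k) agrees with \<alpha>(N) up to the factor 1 + h.\<close>
    define s where "s = real N / w"
    define D where "D = dscale k / 2 ^ r"
    define m where "m = block_length r k"
    have w: "w > 0" by (simp add: w_def)
    have kr: "2 ^ k \<le> real N" "real N < 2 * 2 ^ k"
      using k by (metis of_nat_le_iff of_nat_numeral of_nat_power)
        (metis k(2) of_nat_less_iff of_nat_numeral of_nat_power power_Suc)
    have s: "2 ^ r \<le> s" "s < 2 * 2 ^ r"
      using kr unfolding s_def w_def by (auto simp: field_simps)
    have D: "D > 0" by (simp add: D_def)
    have m: "real m \<le> D" "D - 1 \<le> real m"
      using block_length_le[of r k] block_length_gt[of k r] by (auto simp: m_def D_def)
    have Dh: "1 \<le> h * D" using k0(1) h(1) unfolding D_def by (simp add: field_simps)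
    have sD: "s * D = real N / trunc_mean (2 ^ k)"
      unfolding s_def D_def w_def dscale_def by simp
    have LN: "trunc_mean (2 ^ k) \<le> trunc_mean N" by (rule trunc_mean_mono[OF k(1)])
    have LN': "trunc_mean N \<le> (1 + h) * trunc_mean (2 ^ k)"
    proof -
      have "trunc_mean N \<le> trunc_mean (2 ^ Suc k)" using k(2) by (intro trunc_mean_mono) simp
      also have "\<dots> \<le> (1 + tail_ratio k) * trunc_mean (2 ^ k)" by (rule trunc_mean_double)
      also have "\<dots> \<le> (1 + h) * trunc_mean (2 ^ k)" using k0(2) by (intro mult_right_mono) (auto simp: less_imp_le)
      finally show ?thesis .
    qed
    have N0: "real N > 0" using \<open>N \<ge> 1\<close> by simp
    have LNpos: "trunc_mean N > 0" using trunc_mean_ge_1[OF \<open>N \<ge> 1\<close>] by simp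
    define A where "A = real N / trunc_mean N"
    have A: "A > 0" using N0 LNpos by (simp add: A_def)
    have A_le: "A \<le> s * D" unfolding A_def sD using LN N0 LNpos by (intro divide_left_mono) auto
    have A_ge: "s * D \<le> (1 + h) * A" unfolding A_def sD
      using LN' N0 LNpos h(1) mult_left_mono[OF LN', of "real N"] by (simp add: field_simps)
    have s12: "12 \<le> h * s"
    proof -
      have "12 \<le> h * 2 ^ r" using rh by (simp add: field_simps)
      also have "\<dots> \<le> h * s" using s h(1) by (intro mult_left_mono) auto
      finally show ?thesis .
    qed
    define z where "z = nat \<lfloor>s\<rfloor>"
    have z: "real z \<le> s" "s < real z + 1" using s r16 by (auto simp: z_def)
    have up: "C N \<le> (1 + h) * (1 + h) * A"
    proof -
      \<comment> \<open>12 = 10 + 2: ten units for the error in the law, and z + 2 > s.\<close>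
      have "real (z + 12) \<le> 3 * 2 ^ r" using z s r16 by linarith
      then have p: "z + 12 \<le> 3 * 2 ^ r"
        by (metis of_nat_le_iff of_nat_mult of_nat_numeral of_nat_power)
      have "real (z + 12) * w - 10 * w \<le> real (trimmed_sum x ((z + 12) * m))"
        using k0(3)[OF p] unfolding w_def m_def by linarith
      moreover have "s * w < real (z + 12) * w - 10 * w"
        using z(2) w by (simp flip: left_diff_distrib)
      ultimately have "real N < real (trimmed_sum x ((z + 12) * m))" using w by (simp add: s_def)
      then have "C N \<le> real ((z + 12) * m)" using upper by (simp only: of_nat_less_iff)
      also have "\<dots> \<le> (s + 12) * D" using z m D by (simp only: of_nat_mult of_nat_add) (intro mult_mono; simp)
      also have "\<dots> \<le> (1 + h) * s * D" using s12 D by (intro mult_right_mono) (auto simp: algebra_simps)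
      also have "\<dots> \<le> (1 + h) * ((1 + h) * A)" using A_ge h(1) by (simp add: mult.assoc)
      finally show ?thesis by (simp add: mult.assoc)
    qed
    have lo: "(1 - h) * (1 - h) * A \<le> C N"
    proof -
      have D1: "1 \<le> D" using Dh mult_right_mono[OF h(2), of D] D by linarith
      \<comment> \<open>11 = 10 + 1: ten units for the error in the law, and z - 1 < s.\<close>
      have z11: "11 \<le> z" using z r16 s by linarith
      then have rz: "real (z - 11) = real z - 11" by (simp add: of_nat_diff)
      have "real (z - 11) \<le> 3 * 2 ^ r" using z s rz by linarith
      then have p: "z - 11 \<le> 3 * 2 ^ r"
        by (metis of_nat_le_iff of_nat_mult of_nat_numeral of_nat_power)
      have "real (trimmed_sum x ((z - 11) * m)) \<le> real (z - 11) * w + 10 * w"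
        using k0(3)[OF p] unfolding w_def m_def by linarith
      also have "\<dots> < s * w"
        using z(1) w rz by (simp flip: distrib_right)
      finally have "real (trimmed_sum x ((z - 11) * m)) < real N" using w by (simp add: s_def)
      then have "real ((z - 11) * m) \<le> C N" using lower by (simp only: of_nat_less_iff)
      moreover have "(s - 12) * (D - 1) \<le> real (z - 11) * real m"
        using z m s r16 rz D1 by (intro mult_mono) auto
      moreover have "((1 - h) * s) * ((1 - h) * D) \<le> (s - 12) * (D - 1)"
        using s12 Dh h s r16 D by (intro mult_mono) (auto simp: algebra_simps)
      moreover have "(1 - h) * (1 - h) * A \<le> (1 - h) * (1 - h) * (s * D)"
        using A_le h by (intro mult_left_mono) auto
      ultimately show ?thesis by (simp add: mult_ac)
    qed
    have "C N / A \<le> (1 + h) * (1 + h)" "(1 - h) * (1 - h) \<le> C N / A"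
      using up lo A by (simp_all add: field_simps)
    moreover have "(1 + h) * (1 + h) < 1 + e" "1 - e < (1 - h) * (1 - h)"
    proof -
      define g where "g = h * h"
      have g: "g \<le> h * 1" unfolding g_def using h by (intro mult_left_mono) auto
      have g0: "0 \<le> g" by (simp add: g_def)
      have eqs: "(1 + h) * (1 + h) = 1 + 2 * h + g" "(1 - h) * (1 - h) = 1 - 2 * h + g"
        by (simp_all add: g_def algebra_simps)
      show "(1 + h) * (1 + h) < 1 + e" "1 - e < (1 - h) * (1 - h)"
        unfolding eqs using h g g0 by linarith+
    qed
    ultimately show "norm (C N / (real N / trunc_mean N) - 1) < e"
      unfolding A_def[symmetric] by (simp add: abs_less_iff)
  qed
qed

text \<open>For the passage from T x to x, which shifts N by one. The quotient is at least N / (N +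
  1) because \<open>trunc_mean\<close> increases, and at most 1 by \<open>frac_mono\<close>.\<close>

lemma frac_Suc_lim: "(\<lambda>N. (real N / trunc_mean N) / (real (Suc N) / trunc_mean (Suc N))) \<longlonglongrightarrow> 1"
proof (rule tendsto_sandwich)
  have bounds: "real N / real (Suc N) \<le> (real N / trunc_mean N) / (real (Suc N) / trunc_mean (Suc N)) \<and>
      (real N / trunc_mean N) / (real (Suc N) / trunc_mean (Suc N)) \<le> 1" if "N \<ge> 1" for N
  proof -
    have L: "trunc_mean N \<ge> 1" "trunc_mean N \<le> trunc_mean (Suc N)"
      using trunc_mean_ge_1[OF that] trunc_mean_mono[of N "Suc N"] by auto
    have "real N / real (Suc N) * 1 \<le> real N / real (Suc N) * (trunc_mean (Suc N) / trunc_mean N)"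
      using L by (intro mult_left_mono) auto
    also have "\<dots> = (real N / trunc_mean N) / (real (Suc N) / trunc_mean (Suc N))" by simp
    finally have lo: "real N / real (Suc N) \<le> (real N / trunc_mean N) / (real (Suc N) / trunc_mean (Suc N))" by simp
    have "real N / trunc_mean N \<le> real (Suc N) / trunc_mean (Suc N)"
      using that by (intro frac_mono) auto
    moreover have "real (Suc N) / trunc_mean (Suc N) > 0" using L by simp
    ultimately have "(real N / trunc_mean N) / (real (Suc N) / trunc_mean (Suc N)) \<le> 1"
      by (simp only: divide_le_eq_1_pos)
    with lo show ?thesis by blast
  qed
  show "\<forall>\<^sub>F N in sequentially. real N / real (Suc N) \<le> (real N / trunc_mean N) / (real (Suc N) / trunc_mean (Suc N))"
    "\<forall>\<^sub>F N in sequentially. (real N / trunc_mean N) / (real (Suc N) / trunc_mean (Suc N)) \<le> 1"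
    by (rule eventually_sequentiallyI[of 1], use bounds in blast)+
  show "(\<lambda>N. real N / real (Suc N)) \<longlonglongrightarrow> 1" by (rule LIMSEQ_n_over_Suc_n)
qed simp

end

text \<open>Let M be the largest of the first j terms. If M \<le> m, then S j is the trimmed sum
  plus M, which gives the first implication. If M = x i > m, this term starts at S i > N; removing
  it leaves at least S i, so the trimmed sum is not below N. Conversely, m = x i with S i \<le> N:
  for i < j trimming removes at least m, and for i \<ge> j already S j \<le> S i \<le> N.\<close>

lemma trimmed_sum_count:
  fixes x :: "nat \<Rightarrow> nat" and N :: nat
  assumes pos: "\<And>i. 1 \<le> x i"
  defines "S \<equiv> \<lambda>n. \<Sum>i<n. x i"
  defines "m \<equiv> Max (x ` {j. S j \<le> N})"
  shows "finite {j. S j \<le> N}"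
    and "trimmed_sum x j < N \<Longrightarrow> S j < N + m"
    and "S j < N + m \<Longrightarrow> trimmed_sum x j \<le> N"
proof -
  have S_ge: "j \<le> S j" for j unfolding S_def
    using sum_mono[of "{..<j}" "\<lambda>_. 1" x] pos by simp
  have S_mono: "i \<le> j \<Longrightarrow> S i \<le> S j" for i j
    unfolding S_def by (rule sum_mono2) auto
  show fin: "finite {j. S j \<le> N}"
    by (rule finite_subset[of _ "{..N}"]) (use S_ge order_trans in auto)
  have ne: "{j. S j \<le> N} \<noteq> {}" by (auto simp: S_def intro: exI[of _ 0])
  let ?M = "Max (insert 0 (x ` {..<j}))"
  have eq: "trimmed_sum x j + ?M = S j" unfolding S_def by (rule trimmed_sum_plus_Max)
  have le_m: "S i \<le> N \<Longrightarrow> x i \<le> m" for i unfolding m_def using fin by simp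
  have le_M: "i < j \<Longrightarrow> x i \<le> ?M" for i by (intro Max_ge) auto
  show "S j < N + m" if t: "trimmed_sum x j < N"
  proof (cases "?M \<le> m")
    case True
    then show ?thesis using t eq by linarith
  next
    case False
    have "?M \<in> insert 0 (x ` {..<j})" by (rule Max_in) auto
    moreover have "?M \<noteq> 0" using False by linarith
    ultimately obtain i where i: "i < j" "?M = x i" by auto
    have "\<not> S i \<le> N" using le_m[of i] False i by auto
    moreover have "S i + x i \<le> S j" using S_mono[of "Suc i" j] i by (simp add: S_def)
    ultimately show ?thesis using t eq i by linarith
  qed
  show "trimmed_sum x j \<le> N" if t: "S j < N + m"
  proof -
    have "m \<in> x ` {j. S j \<le> N}" unfolding m_def using fin ne by (intro Max_in) auto
    then obtain i where i: "S i \<le> N" "m = x i" by blast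
    show ?thesis
    proof (cases "i < j")
      case True
      then show ?thesis using le_M[of i] i eq t by linarith
    next
      case False
      then show ?thesis using S_mono[of j i] i eq by simp
    qed
  qed
qed

section \<open>Entry times, visits and excursions\<close>

context recurrent_system
begin

abbreviation entry_time :: "'a \<Rightarrow> nat \<Rightarrow> nat" where
  "entry_time x n \<equiv> \<Sum>i<n. return_times T E i x"

lemma induced_funpow_eq: "(induced_map T E ^^ n) x = (T ^^ entry_time x n) x"
proof (induction n)
  case (Suc n)
  have "(induced_map T E ^^ Suc n) x = (T ^^ return_times T E n x) ((induced_map T E ^^ n) x)"
    by (simp add: induced_map_def return_times_def)
  then show ?case using Suc by (simp add: funpow_add add.commute)
qed simp

context
  fixes y assumes yE: "y \<in> E" and y_rec: "recurrent y"
begin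

lemma return_times_ge_1: "1 \<le> return_times T E i y"
  unfolding return_times_def using return_time_props(1) y_rec by (simp add: recurrent_induced_funpow)

lemma entry_time_visit: "(T ^^ entry_time y n) y \<in> E"
  unfolding induced_funpow_eq[symmetric] by (rule induced_funpow_in_E[OF yE y_rec])

lemma entry_time_strict_mono: "strict_mono (entry_time y)"
  using return_times_ge_1 by (intro strict_monoI_Suc) (simp add: Suc_le_eq)

lemma between_entry_times:
  assumes "entry_time y n < l" "l < entry_time y (Suc n)"
  shows "(T ^^ l) y \<notin> E"
proof -
  let ?z = "(induced_map T E ^^ n) y"
  have "(T ^^ (l - entry_time y n)) ?z \<notin> E"
    using assms y_rec
    by (intro return_time_props(3)) (auto simp: recurrent_induced_funpow return_times_def)
  moreover have "(T ^^ l) y = (T ^^ (l - entry_time y n)) ?z"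
    using assms unfolding induced_funpow_eq by (simp flip: funpow_add[THEN fun_cong, unfolded o_apply])
  ultimately show ?thesis by simp
qed

lemma entry_time_bracket:
  assumes "1 \<le> l" obtains n where "entry_time y n < l" "l \<le> entry_time y (Suc n)"
proof -
  let ?P = "\<lambda>n. l \<le> entry_time y (Suc n)"
  have "l \<le> entry_time y l" using entry_time_strict_mono by (rule strict_mono_imp_increasing)
  also have "\<dots> \<le> entry_time y (Suc l)" by simp
  finally have P: "?P l" .
  define n where "n = (LEAST n. ?P n)"
  have 1: "?P n" unfolding n_def using P by (rule LeastI)
  have "entry_time y n < l"
  proof (cases n)
    case (Suc k)
    then have "\<not> ?P k" using not_less_Least[of k ?P] unfolding n_def by simp
    then show ?thesis using Suc by simp
  qed (use assms in simp)
  with 1 that show thesis by blast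
qed

lemma visit_iff: "(T ^^ l) y \<in> E \<longleftrightarrow> l \<in> range (entry_time y)"
proof
  assume v: "(T ^^ l) y \<in> E"
  show "l \<in> range (entry_time y)"
  proof (cases "l = 0")
    case False
    then obtain n where "entry_time y n < l" "l \<le> entry_time y (Suc n)"
      using entry_time_bracket[of l] by auto
    then have "l = entry_time y (Suc n)" using between_entry_times[of n l] v by (auto simp: le_less)
    then show ?thesis by blast
  qed (auto intro!: image_eqI[of _ _ 0])
qed (use entry_time_visit in auto)

lemma visits_eq: "visits K y = real (card {j. entry_time y j < K})"
proof -
  have eq: "{k\<in>{..<K}. (T ^^ k) y \<in> E} = entry_time y ` {j. entry_time y j < K}"
    unfolding visit_iff by auto
  have card: "card (entry_time y ` {j. entry_time y j < K}) = card {j. entry_time y j < K}"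
    by (rule card_image) (rule inj_on_subset[OF strict_mono_imp_inj_on[OF entry_time_strict_mono] subset_UNIV])
  have "visits K y = (\<Sum>k<K. if (T ^^ k) y \<in> E then 1 else 0)"
    unfolding birkhoff_def indicator_def by (intro sum.cong) auto
  also have "\<dots> = (\<Sum>k\<in>{k\<in>{..<K}. (T ^^ k) y \<in> E}. 1)"
    by (rule sum.inter_filter[symmetric]) simp
  finally show ?thesis unfolding eq by (simp add: card)
qed

text \<open>The excursion after the visit at \<open>S i\<close> stays outside E for one step less
  than its duration, which explains the summand 1 in m(N). It starts at position S i + 1, so
  positions up to N + 1 belong to visits at times up to N. A run that begins inside an excursion is
  a part of it and no longer.\<close>

lemma longest_excursion_eq:
  "longest_excursion T N E y = Max ((\<lambda>i. return_times T E i y) ` {j. entry_time y j \<le> N})"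
proof -
  define S where "S n = entry_time y n" for n
  define z where "z i = return_times T E i y" for i
  define m where "m = Max (z ` {j. S j \<le> N})"
  define D where "D = {k. 1 \<le> k \<and> (\<exists>l\<in>{1..N + 1}. \<forall>j<k. (T ^^ (l + j)) y \<notin> E)}"
  have S_Suc: "S (Suc n) = S n + z n" and S_visit: "(T ^^ S n) y \<in> E" for n
    using entry_time_visit by (simp_all add: S_def z_def)
  have fin: "finite {j. S j \<le> N}"
    unfolding S_def by (rule trimmed_sum_count(1)[OF return_times_ge_1])
  have "S 0 \<le> N" by (simp add: S_def)
  then have ne: "{j. S j \<le> N} \<noteq> {}" by blast
  have a: "k + 1 \<le> m" if k: "k \<in> D" for k
  proof -
    from k obtain l where l: "l \<in> {1..N + 1}" "\<forall>j<k. (T ^^ (l + j)) y \<notin> E"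
      unfolding D_def by blast
    obtain n where n: "S n < l" "l \<le> S (Suc n)"
      using entry_time_bracket[of l] l(1) unfolding S_def by force
    \<comment> \<open>Otherwise the run would contain the next visit.\<close>
    have "\<not> S (Suc n) - l < k"
    proof
      assume "S (Suc n) - l < k"
      with l(2) have "(T ^^ (l + (S (Suc n) - l))) y \<notin> E" by blast
      then show False using n(2) S_visit[of "Suc n"] by simp
    qed
    then have "k + 1 \<le> z n" using n S_Suc[of n] by linarith
    also have "S n \<le> N" using n(1) l(1) by simp
    then have "z n \<le> m" unfolding m_def using fin by simp
    finally show ?thesis .
  qed
  have "m \<in> z ` {j. S j \<le> N}" unfolding m_def using fin ne by (intro Max_in) auto
  then obtain i where i: "S i \<le> N" "m = z i" by blast
  have m1: "1 \<le> m" unfolding i(2) z_def by (rule return_times_ge_1)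
  have "Sup D = m - 1"
  proof (cases "m = 1")
    \<comment> \<open>All these excursions have duration 1; the set of runs is empty and its
      \<open>Sup\<close> is 0.\<close>
    case True
    have "k \<notin> D" for k using a[of k] True unfolding D_def by force
    then have "D = {}" by blast
    then show ?thesis using True by simp
  next
    case False
    have "(T ^^ (S i + 1 + j)) y \<notin> E" if "j < m - 1" for j
      using between_entry_times[of i "S i + 1 + j"] that i(2) S_Suc[of i] unfolding S_def by linarith
    moreover have "S i + 1 \<in> {1..N + 1}" using i(1) by simp
    moreover have "1 \<le> m - 1" using False m1 by linarith
    ultimately have "m - 1 \<in> D" unfolding D_def by blast
    moreover have "k \<le> m - 1" if "k \<in> D" for k using a[OF that] by linarith
    ultimately show ?thesis by (rule cSup_eq_maximum)
  qed
  then show ?thesis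
    unfolding longest_excursion_def D_def[symmetric] S_def[symmetric]
    unfolding z_def[symmetric] m_def[symmetric] using m1 by linarith
qed

text \<open>By \<open>trimmed_sum_count\<close> and the monotonicity of trimmed sums, the set of
  indices counted by \<open>visits\<close> contains, respectively is contained in, the indices below
  n.\<close>

lemma visits_trimmed:
  shows "trimmed_sum (\<lambda>i. return_times T E i y) n < N \<Longrightarrow> real n \<le> visits (N + longest_excursion T N E y) y"
    and "trimmed_sum (\<lambda>i. return_times T E i y) n > N \<Longrightarrow> visits (N + longest_excursion T N E y) y \<le> real n"
proof -
  let ?x = "\<lambda>i. return_times T E i y"
  let ?m = "longest_excursion T N E y"
  note cnt = trimmed_sum_count(2,3)[of ?x _ N, OF return_times_ge_1, folded longest_excursion_eq]
  have inc: "j \<le> entry_time y j" for j using entry_time_strict_mono by (rule strict_mono_imp_increasing)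
  have fin: "finite {j. entry_time y j < N + ?m}"
    by (rule finite_subset[of _ "{..N + ?m}"]) (use inc in \<open>auto intro: order_trans[OF inc] less_imp_le\<close>)
  show "real n \<le> visits (N + ?m) y" if "trimmed_sum ?x n < N"
  proof -
    have "{..<n} \<subseteq> {j. entry_time y j < N + ?m}"
    proof
      fix j assume "j \<in> {..<n}"
      then have "trimmed_sum ?x j < N" using trimmed_sum_mono[of j n ?x] that by simp
      then show "j \<in> {j. entry_time y j < N + ?m}" using cnt(1) by simp
    qed
    from card_mono[OF fin this] show ?thesis unfolding visits_eq by simp
  qed
  show "visits (N + ?m) y \<le> real n" if "trimmed_sum ?x n > N"
  proof -
    have "{j. entry_time y j < N + ?m} \<subseteq> {..<n}"
    proof
      fix j assume "j \<in> {j. entry_time y j < N + ?m}"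
      then have "trimmed_sum ?x j \<le> N" using cnt(2) by simp
      then have "\<not> n \<le> j" using trimmed_sum_mono[of n j ?x] that by auto
      then show "j \<in> {..<n}" by simp
    qed
    from card_mono[OF _ this] show ?thesis unfolding visits_eq by simp
  qed
qed

end

text \<open>Passing from T x to x shifts the starting positions by one and adds position 1. A run
  from there is stopped by the visit at time R + 1, so its length is at most R. Recurrence bounds
  all runs, as \<open>Sup\<close> on \<open>nat\<close> requires.\<close>

lemma longest_excursion_T:
  assumes R: "(T ^^ Suc R) x \<in> E" and x: "recurrent x"
  shows "longest_excursion T N E (T x) \<le> longest_excursion T (Suc N) E x"
    and "longest_excursion T (Suc N) E x \<le> longest_excursion T N E (T x) + R"
proof -
  let ?D = "\<lambda>N x. {k. 1 \<le> k \<and> (\<exists>l\<in>{1..N + 1}. \<forall>j<k. (T ^^ (l + j)) x \<notin> E)}"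
  have bdd: "bdd_above (?D N x)" if "recurrent x" for N x
  proof -
    from that obtain v where v: "v \<ge> N + 1" "(T ^^ v) x \<in> E" unfolding recurrent_def by blast
    have "k \<le> v" if k: "k \<in> ?D N x" for k
    proof (rule ccontr)
      assume "\<not> k \<le> v"
      from k obtain l where l: "l \<in> {1..N + 1}" "\<forall>j<k. (T ^^ (l + j)) x \<notin> E" by blast
      then have "(T ^^ (l + (v - l))) x \<notin> E" using \<open>\<not> k \<le> v\<close> by simp
      then show False using v l(1) by simp
    qed
    then show ?thesis by (rule bdd_aboveI)
  qed
  have shift: "(T ^^ (Suc l + j)) x = (T ^^ (l + j)) (T x)" for l j
    by (simp add: funpow_swap1)
  have sub: "?D N (T x) \<subseteq> ?D (Suc N) x"
  proof
    fix k assume "k \<in> ?D N (T x)"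
    then obtain l where l: "1 \<le> k" "l \<in> {1..N + 1}" "\<forall>j<k. (T ^^ (l + j)) (T x) \<notin> E" by blast
    then have "\<forall>j<k. (T ^^ (Suc l + j)) x \<notin> E" "Suc l \<in> {1..Suc N + 1}"
      unfolding shift by auto
    then show "k \<in> ?D (Suc N) x" using l(1) by blast
  qed
  have lo: "Sup (?D N (T x)) \<le> Sup (?D (Suc N) x)"
  proof (cases "?D N (T x) = {}")
    case False
    then show ?thesis by (intro cSup_subset_mono bdd x sub)
  qed (simp only: Sup_nat_empty le0)
  have up: "Sup (?D (Suc N) x) \<le> Sup (?D N (T x)) + R"
  proof (cases "?D (Suc N) x = {}")
    case False
    then show ?thesis
    proof (rule cSup_least)
      fix k assume k: "k \<in> ?D (Suc N) x"
      then obtain l where l: "1 \<le> k" "l \<in> {1..Suc N + 1}" "\<forall>j<k. (T ^^ (l + j)) x \<notin> E" by blast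
      show "k \<le> Sup (?D N (T x)) + R"
      proof (cases "l = 1")
        case True
        then have "\<not> R < k" using l(3) R by (auto dest!: spec[of _ R])
        then show ?thesis by simp
      next
        case False
        then obtain l' where l': "l = Suc l'" "l' \<in> {1..N + 1}" using l(2) by (cases l) auto
        then have "\<forall>j<k. (T ^^ (l' + j)) (T x) \<notin> E" using l(3) unfolding l'(1) shift by blast
        then have "k \<in> ?D N (T x)" using l(1) l'(2) by blast
        then have "k \<le> Sup (?D N (T x))" by (intro cSup_upper bdd) (simp_all add: recurrent_T x)
        then show ?thesis by simp
      qed
    qed
  qed (simp only: Sup_nat_empty le0)
  show "longest_excursion T N E (T x) \<le> longest_excursion T (Suc N) E x"
    "longest_excursion T (Suc N) E x \<le> longest_excursion T N E (T x) + R"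
    unfolding longest_excursion_def using lo up by simp_all
qed

abbreviation excursion_limit :: "'a \<Rightarrow> bool" where
  "excursion_limit x \<equiv>
     (\<lambda>N. visits (N + longest_excursion T N E x) x / alpha M T E N) \<longlonglongrightarrow> 1"

text \<open>The counts for x at N + 1 and for T x at N differ by at most R + 1: one for time 0 and R
  for the longer wait. This is negligible as the counts diverge, and \<open>alpha_Suc\<close>
  absorbs the shift of N.\<close>

lemma excursion_limit_T:
  assumes alpha_pos: "\<forall>\<^sub>F N in sequentially. alpha M T E N > 0"
    and alpha_Suc: "(\<lambda>N. alpha M T E N / alpha M T E (Suc N)) \<longlonglongrightarrow> 1"
    and x: "recurrent x" and lim: "excursion_limit (T x)"
  shows "excursion_limit x"
proof -
  let ?\<alpha> = "alpha M T E"
  define u where "u N = visits (N + longest_excursion T N E (T x)) (T x)" for N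
  define v where "v N = visits (Suc N + longest_excursion T (Suc N) E x) x" for N
  from x obtain k where k: "k \<ge> 1" "(T ^^ k) x \<in> E" unfolding recurrent_def by blast
  then obtain R where R: "(T ^^ Suc R) x \<in> E" by (cases k) auto
  note le = longest_excursion_T[OF R x]
  have bounds: "u N \<le> v N \<and> v N \<le> u N + real (Suc R)" for N
  proof -
    have v: "v N = indicator E x + visits (N + longest_excursion T (Suc N) E x) (T x)"
      unfolding v_def by (simp add: birkhoff_Suc)
    have "u N \<le> visits (N + longest_excursion T (Suc N) E x) (T x)"
      unfolding u_def using le(1)[of N] by (intro visits_mono) simp
    moreover have "visits (N + longest_excursion T (Suc N) E x) (T x)
        \<le> visits (N + longest_excursion T N E (T x) + R) (T x)"
      using le(2)[of N] by (intro visits_mono) simp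
    moreover have "\<dots> \<le> u N + real R" unfolding u_def by (rule visits_le)
    ultimately show ?thesis unfolding v by (auto simp: indicator_def)
  qed
  have u_top: "filterlim u at_top sequentially"
  proof (rule filterlim_at_top_mono[OF visits_at_top])
    show "recurrent (T x)" using x by (simp add: recurrent_T)
    show "\<forall>\<^sub>F N in sequentially. visits N (T x) \<le> u N"
      unfolding u_def by (intro always_eventually allI visits_mono) simp
  qed
  have lim_u: "(\<lambda>N. u N / ?\<alpha> N) \<longlonglongrightarrow> 1" using lim unfolding u_def .
  have inv_u: "(\<lambda>N. inverse (u N)) \<longlonglongrightarrow> 0" by (rule tendsto_inverse_0_at_top[OF u_top])
  have "(\<lambda>N. u N / ?\<alpha> N * (1 + real (Suc R) * inverse (u N))) \<longlonglongrightarrow> 1 * (1 + real (Suc R) * 0)"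
    by (intro tendsto_intros lim_u inv_u)
  then have up: "(\<lambda>N. u N / ?\<alpha> N * (1 + real (Suc R) * inverse (u N))) \<longlonglongrightarrow> 1" by simp
  have "\<forall>\<^sub>F N in sequentially. u N > 0" using u_top unfolding filterlim_at_top_dense by blast
  with alpha_pos have "\<forall>\<^sub>F N in sequentially. u N / ?\<alpha> N \<le> v N / ?\<alpha> N
      \<and> v N / ?\<alpha> N \<le> u N / ?\<alpha> N * (1 + real (Suc R) * inverse (u N))"
  proof eventually_elim
    case (elim N)
    have "u N / ?\<alpha> N * (1 + real (Suc R) * inverse (u N)) = (u N + real (Suc R)) / ?\<alpha> N"
      using elim by (simp add: field_simps)
    then show ?case using bounds[of N] elim by (simp add: divide_right_mono)
  qed
  then have "(\<lambda>N. v N / ?\<alpha> N) \<longlonglongrightarrow> 1"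
    by (intro tendsto_sandwich[OF _ _ lim_u up]) (auto elim: eventually_mono)
  from tendsto_mult[OF this alpha_Suc]
  have "(\<lambda>N. v N / ?\<alpha> N * (?\<alpha> N / ?\<alpha> (Suc N))) \<longlonglongrightarrow> 1" by simp
  moreover have "\<forall>\<^sub>F N in sequentially. v N / ?\<alpha> N * (?\<alpha> N / ?\<alpha> (Suc N)) = v N / ?\<alpha> (Suc N)"
    using alpha_pos by eventually_elim simp
  ultimately have "(\<lambda>N. v N / ?\<alpha> (Suc N)) \<longlonglongrightarrow> 1" by (rule Lim_transform_eventually)
  then show ?thesis unfolding v_def by (rule LIMSEQ_imp_Suc)
qed

lemma excursion_limit_funpow:
  assumes "\<forall>\<^sub>F N in sequentially. alpha M T E N > 0"
    and "(\<lambda>N. alpha M T E N / alpha M T E (Suc N)) \<longlonglongrightarrow> 1"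
    and "recurrent x" and "excursion_limit ((T ^^ n) x)"
  shows "excursion_limit x"
  using assms(3,4)
proof (induction n arbitrary: x)
  case (Suc n)
  have "excursion_limit ((T ^^ n) (T x))"
    using Suc.prems(2) unfolding funpow_Suc_right o_apply .
  moreover have "recurrent (T x)" using Suc.prems(1) by (simp add: recurrent_T)
  ultimately have "excursion_limit (T x)" by (rule Suc.IH[rotated])
  then show ?case by (rule excursion_limit_T[OF assms(1,2) Suc.prems(1)])
qed simp

section \<open>Preparing the hypotheses of the abstract law\<close>

lemma return_tail_sets [measurable]: "return_tail T E j \<in> sets M"
proof -
  have "return_tail T E j = {x\<in>space M. x \<in> E \<and> return_time T E x > j}"
    using sets.sets_into_space[OF E_sets] by (auto simp: return_tail_def)
  then show ?thesis by simp
qed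

lemma emeasure_return_tail_finite: "emeasure M (return_tail T E j) \<noteq> \<infinity>"
  using emeasure_mono[of "return_tail T E j" E M] E_one
  by (auto simp: return_tail_def top_unique)

text \<open>The set differs from E by the points of E that never return, whose return time is 0 by
  convention.\<close>

lemma measure_return_tail_0: "measure M (return_tail T E 0) = 1"
proof -
  have "measure M (return_tail T E 0) = measure M E"
  proof (rule measure_eq_AE)
    show "AE x in M. (x \<in> return_tail T E 0) = (x \<in> E)"
      using AE_recurrent by eventually_elim (use return_time_props(1) in \<open>force simp: return_tail_def\<close>)
  qed auto
  then show ?thesis using E_one by (simp add: measure_def)
qed

lemma measure_return_tail_mono: "m \<le> n \<Longrightarrow> measure M (return_tail T E n) \<le> measure M (return_tail T E m)"
proof -
  assume "m \<le> n"
  then have "return_tail T E n \<subseteq> return_tail T E m" by (auto simp: return_tail_def)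
  then show ?thesis
    unfolding measure_def using emeasure_return_tail_finite
    by (intro enn2real_mono emeasure_mono) (auto simp: less_top)
qed

lemma generated_events_return_prob:
  "A \<in> generated_events return_prob (count_space UNIV) (return_times T E) I \<Longrightarrow> A \<in> sets return_prob"
proof -
  have "generated_events return_prob (count_space UNIV) (return_times T E) I \<subseteq> sets return_prob"
    unfolding generated_events_def
    by (rule sets.sigma_sets_subset)
      (use measurable_sets[OF measurable_restrict_space1[OF return_times_meas]] in blast)
  then show "A \<in> generated_events return_prob (count_space UNIV) (return_times T E) I \<Longrightarrow> A \<in> sets return_prob"
    by blast
qed

end

text \<open>The supremum bounds the quotient for events of positive probability; if one of them is
  null, both sides vanish.\<close>

lemma psi_coeff_bound:
  fixes P :: "'b measure" and S :: "'c measure"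
  assumes "prob_space P" and fin: "psi_coeff P S Y n \<noteq> \<infinity>"
    and B: "B \<in> generated_events P S Y {0..j}" and C: "C \<in> generated_events P S Y {j + n..}"
    and ev: "B \<in> sets P" "C \<in> sets P"
  shows "measure P (B \<inter> C) \<le> (1 + enn2real (psi_coeff P S Y n)) * (measure P B * measure P C)"
proof -
  interpret prob_space P by fact
  show ?thesis
  proof (cases "prob B > 0 \<and> prob C > 0")
    case True
    define q where "q = prob B * prob C"
    have q: "q > 0" using True by (simp add: q_def)
    have "ennreal \<bar>prob (B \<inter> C) / (prob B * prob C) - 1\<bar> \<le> psi_coeff P S Y n"
      unfolding psi_coeff_def using B C True by (intro Sup_upper) blast
    also have "\<dots> = ennreal (enn2real (psi_coeff P S Y n))" using fin by (simp add: less_top)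
    finally have "\<bar>prob (B \<inter> C) / q - 1\<bar> \<le> enn2real (psi_coeff P S Y n)"
      by (simp add: q_def)
    then have "prob (B \<inter> C) / q \<le> 1 + enn2real (psi_coeff P S Y n)" by linarith
    then show ?thesis using q unfolding q_def[symmetric] by (simp add: pos_divide_le_eq)
  next
    case False
    then have "prob B = 0 \<or> prob C = 0" by (metis measure_nonneg order_le_less)
    moreover have "prob (B \<inter> C) \<le> prob B" "prob (B \<inter> C) \<le> prob C"
      using ev by (auto intro!: finite_measure_mono)
    ultimately show ?thesis by auto
  qed
qed

theorem theorem2p3:
  fixes M :: "'a measure" and T :: "'a \<Rightarrow> 'a" and E :: "'a set" and f :: "'a \<Rightarrow> real"
  assumes "sigma_finite_measure M"
    and "emeasure M (space M) = \<infinity>"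
    and "measure_preserving M T"
    and "conservative M T"
    and "ergodic M T"
    and "E \<in> sets M"
    and "emeasure M E = 1"
    and "psi_mixing (restrict_space M E) (count_space UNIV) (return_times T E)"
    and "(\<Sum>n. psi_coeff (restrict_space M E) (count_space UNIV) (return_times T E) (Suc n)
            / of_nat (Suc n)) < \<infinity>"
    and "summable (\<lambda>n. real n * (measure M (return_tail T E n))\<^sup>2
            / (\<Sum>j<n. measure M (return_tail T E j))\<^sup>2)"
    and "integrable M f"
  shows "AE x in M.
           (\<lambda>N. (1 / alpha M T E N) *
                  (\<Sum>k=1..N + longest_excursion T N E x. f ((T ^^ (k - 1)) x)))
             \<longlonglongrightarrow> (LINT x|M. f x)"
proof -
  interpret recurrent_system M T E
    using assms(3-7) by unfold_locales (auto simp: measure_preserving_def)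
  define a where "a j = measure M (return_tail T E j)" for j
  define c where "c = psi_coeff return_prob (count_space UNIV) (return_times T E)"
  \<comment> \<open>The coefficient at n = 0 may be infinite, in which case \<open>enn2real\<close>
    gives 0; finiteness and \<open>mix\<close> are established for n \<ge> 1.\<close>
  define \<psi> where "\<psi> n = enn2real (c n)" for n
  have sum_fin: "(\<Sum>n. c (Suc n) / of_nat (Suc n)) \<noteq> \<infinity>" using assms(9) by (simp add: c_def less_top)
  have c_fin: "c n \<noteq> \<infinity>" if n: "1 \<le> n" for n
  proof
    assume "c n = \<infinity>"
    then have "c (Suc (n - 1)) / of_nat (Suc (n - 1)) = \<infinity>" using n by (simp add: ennreal_top_divide)
    moreover have "c (Suc (n - 1)) / of_nat (Suc (n - 1)) \<le> (\<Sum>n. c (Suc n) / of_nat (Suc n))"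
      using sum_le_suminf[of "\<lambda>n. c (Suc n) / of_nat (Suc n)" "{n - 1}"] by simp
    ultimately show False using sum_fin by (simp add: top_unique)
  qed
  have \<psi>_term: "ennreal (\<psi> (Suc n) / real (Suc n)) = c (Suc n) / of_nat (Suc n)" for n
  proof -
    have "ennreal (\<psi> (Suc n) / real (Suc n)) = ennreal (\<psi> (Suc n)) / ennreal (real (Suc n))"
      by (rule divide_ennreal[symmetric]) (auto simp: \<psi>_def)
    then show ?thesis using c_fin[of "Suc n"] by (simp add: \<psi>_def less_top ennreal_of_nat_eq_real_of_nat)
  qed
  have \<psi>_nonneg: "0 \<le> \<psi> n" for n by (simp add: \<psi>_def)
  have \<psi>_summable: "summable (\<lambda>n. \<psi> (Suc n) / real (Suc n))"
  proof (rule summable_suminf_not_top)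
    show "(\<Sum>n. ennreal (\<psi> (Suc n) / real (Suc n))) \<noteq> \<top>"
      using sum_fin unfolding \<psi>_term by simp
  qed (simp add: \<psi>_nonneg)
  have mix: "measure return_prob (B \<inter> C) \<le> (1 + \<psi> n) * (measure return_prob B * measure return_prob C)"
    if "1 \<le> n" "B \<in> generated_events return_prob (count_space UNIV) (return_times T E) {0..j}"
      "C \<in> generated_events return_prob (count_space UNIV) (return_times T E) {j + n..}" for n j B C
    unfolding \<psi>_def c_def using that c_fin[OF that(1)] unfolding c_def
    by (intro psi_coeff_bound prob_space_return_prob generated_events_return_prob)
  have "tail_sequence a \<psi>"
  proof
    show "a 0 = 1" by (simp add: a_def measure_return_tail_0)
    show "summable (\<lambda>n. real n * (a n)\<^sup>2 / (\<Sum>j<n. a j)\<^sup>2)" using assms(10) by (simp add: a_def)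
  qed (simp_all add: a_def measure_return_tail_mono \<psi>_nonneg \<psi>_summable del: of_nat_Suc)
  then have "mixing_sequence return_prob a \<psi> (return_times T E)"
  proof (intro mixing_sequence.intro mixing_sequence_axioms.intro prob_space_return_prob)
    show "return_times T E n \<in> measurable return_prob (count_space UNIV)" for n
      by (rule measurable_restrict_space1[OF return_times_meas])
    show "measure return_prob {x\<in>space return_prob. return_times T E n x > j} = a j" for n j
      unfolding a_def by (rule return_times_identical)
  qed (assumption, rule mix)
  then interpret mixing_sequence return_prob a \<psi> "return_times T E" .
  have alpha_eq: "alpha M T E N = real N / trunc_mean N" for N
    by (simp add: alpha_def trunc_mean_def a_def)
  have alpha_pos: "\<forall>\<^sub>F N in sequentially. alpha M T E N > 0"
  proof (rule eventually_sequentiallyI[of 1])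
    show "alpha M T E N > 0" if "1 \<le> N" for N
      using that trunc_mean_ge_1[of N] by (simp add: alpha_eq)
  qed
  have alpha_Suc: "(\<lambda>N. alpha M T E N / alpha M T E (Suc N)) \<longlonglongrightarrow> 1"
    using frac_Suc_lim unfolding alpha_eq .
  \<comment> \<open>The quantifier over r moves inside because r ranges over a countable
    set.\<close>
  have "AE y in return_prob. \<forall>r. \<forall>\<^sub>F k in sequentially. \<forall>p\<le>3 * 2 ^ r.
     \<bar>real (trimmed_sum (\<lambda>i. return_times T E i y) (p * block_length r k)) - real p * (2 ^ k / 2 ^ r)\<bar>
       \<le> 10 * (2 ^ k / 2 ^ r)"
    unfolding AE_all_countable using trimmed_sum_law by blast
  then have "AE y in M. y \<in> E \<longrightarrow> (\<forall>r. \<forall>\<^sub>F k in sequentially. \<forall>p\<le>3 * 2 ^ r.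
     \<bar>real (trimmed_sum (\<lambda>i. return_times T E i y) (p * block_length r k)) - real p * (2 ^ k / 2 ^ r)\<bar>
       \<le> 10 * (2 ^ k / 2 ^ r))"
    by (subst (asm) AE_restrict_space_iff) auto
  then have "AE y in M. y \<in> E \<longrightarrow> excursion_limit y"
    using AE_recurrent
  proof eventually_elim
    case (elim y)
    show ?case
    proof
      assume y: "y \<in> E"
      show "excursion_limit y" unfolding alpha_eq
        by (rule count_asymptotics[OF elim(1)[rule_format, OF y] visits_trimmed[OF y elim(2)]])
    qed
  qed
  \<comment> \<open>Almost every x has all its visits to E at good points, so any one of them can
    start the pullback.\<close>
  then have "AE x in M. \<forall>n. (T ^^ n) x \<in> E \<longrightarrow> excursion_limit ((T ^^ n) x)"
    unfolding AE_all_countable using AE_funpow by blast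
  then show ?thesis
    using AE_recurrent hopf_ratio[OF assms(11)]
  proof eventually_elim
    case (elim x)
    from elim(2) obtain n where n: "(T ^^ n) x \<in> E" unfolding recurrent_def by blast
    have lim: "excursion_limit x"
      by (rule excursion_limit_funpow[OF alpha_pos alpha_Suc elim(2) elim(1)[rule_format, OF n]])
    \<comment> \<open>\<open>K N\<close> tends to infinity, so the ratio theorem may be read along
      it; multiplying by the visit count over \<alpha>(N) cancels the visits.\<close>
    define K where "K N = N + longest_excursion T N E x" for N
    have K: "filterlim K sequentially sequentially"
      by (rule filterlim_at_top_mono[OF filterlim_ident]) (simp add: K_def)
    have "(\<lambda>N. birkhoff f (K N) x / visits (K N) x) \<longlonglongrightarrow> (LINT x|M. f x)"
      by (rule filterlim_compose[OF elim(3) K])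
    from tendsto_mult[OF this lim[folded K_def]]
    have "(\<lambda>N. birkhoff f (K N) x / visits (K N) x * (visits (K N) x / alpha M T E N)) \<longlonglongrightarrow> (LINT x|M. f x)"
      by simp
    moreover have "\<forall>\<^sub>F N in sequentially. visits (K N) x > 0"
      using filterlim_compose[OF visits_at_top[OF elim(2)] K] unfolding filterlim_at_top_dense by blast
    then have "\<forall>\<^sub>F N in sequentially. birkhoff f (K N) x / visits (K N) x * (visits (K N) x / alpha M T E N)
      = (1 / alpha M T E N) * (\<Sum>k=1..N + longest_excursion T N E x. f ((T ^^ (k - 1)) x))"
    proof eventually_elim
      case (elim N)
      have "(\<Sum>k=1..K N. f ((T ^^ (k - 1)) x)) = birkhoff f (K N) x"
        unfolding birkhoff_def
        by (rule sum.reindex_bij_witness[where i=Suc and j="\<lambda>k. k - 1"]) auto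
      then show ?case using elim unfolding K_def by simp
    qed
    ultimately show ?case by (rule Lim_transform_eventually)
  qed
qed

end
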